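(* Let $\sigma$ be a type and $\mathcal O\subseteq\mathbb F$ a regular set of $\sigma$-forests. Then the set of (isomorphism classes of) cores of the minimal elements of $\mathcal O$ is regular.
   Context: A type $\sigma$ is a finite set of relation symbols with arities; a $\sigma$-structure $\mathbf A$ is a finite set $V(\mathbf A)$ with an $r$-ary relation $R(\mathbf A)$ for each $R\in\sigma$ of arity $r$. Homomorphisms preserve all relations; $\mathbf A\to\mathbf B$ means one exists. The core of $\mathbf A$ is a structure homomorphically equivalent to $\mathbf A$ with the minimum number of vertices (unique up to isomorphism). An element $\mathbf A\in\mathcal O$ is minimal in $\mathcal O$ if for every $\mathbf C\in\mathcal O$ with $\mathbf C\to\mathbf A$ we have $\mathbf A\to\mathbf C$. The incidence multigraph $\mathrm{Inc}(\mathbf A)$ is bipartite with parts $V(\mathbf A)$ and the blocks $(R,(x_1,\dots,x_r))$, $(x_1,\dots,x_r)\in R(\mathbf A)$, with an edge joining $x_i$ to the block for each $i$. $\mathbf A$ is a $\sigma$-forest if $\mathrm{Inc}(\mathbf A)$ has no cycles or parallel edges. $\mathbb F$ is the set of isomorphism classes of $\sigma$-forests, $\mathbb F_{\mathrm r}$ that of rooted $\sigma$-forests $(\mathbf A,a)$, $a\in V(\mathbf A)$. $(\mathbf A,a)+(\mathbf B,b)$ is the disjoint union with $a,b$ identified (new root); $[(\mathbf A,a)]$ forgets the root. For $\mathcal O\subseteq\mathbb F$, $\mathcal O-(\mathbf A,a)=\{(\mathbf B,b)\in\mathbb F_{\mathrm r}:[(\mathbf A,a)+(\mathbf B,b)]\in\mathcal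 O\}$; $\mathcal O$ is regular if there are only finitely many distinct sets $\mathcal O-(\mathbf A,a)$, $(\mathbf A,a)\in\mathbb F_{\mathrm r}$. *)

theory Defs
  imports Main
begin

text \<open>A type sigma is a finite set sig of relation symbols together with an arity
  function ar. A sigma-structure has a finite vertex set (vertices are naturals; every
  finite structure is isomorphic to one of this form) and, for each symbol R, a set of
  tuples (lists) Rel A R.\<close>

record 'r sstruct =
  V :: "nat set"
  Rel :: "'r \<Rightarrow> nat list set"

definition wf_struct :: "'r set \<Rightarrow> ('r \<Rightarrow> nat) \<Rightarrow> 'r sstruct \<Rightarrow> bool" where
  "wf_struct sig ar A \<longleftrightarrow> finite (V A) \<and> (\<forall>R. R \<notin> sig \<longrightarrow> Rel A R = {}) \<and>
     (\<forall>R\<in>sig. \<forall>xs\<in>Rel A R. length xs = ar R \<and> set xs \<subseteq> V A)"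

definition hom :: "'r sstruct \<Rightarrow> 'r sstruct \<Rightarrow> (nat \<Rightarrow> nat) \<Rightarrow> bool" where
  "hom A B f \<longleftrightarrow> f ` V A \<subseteq> V B \<and> (\<forall>R. \<forall>xs\<in>Rel A R. map f xs \<in> Rel B R)"

definition homto :: "'r sstruct \<Rightarrow> 'r sstruct \<Rightarrow> bool" where
  "homto A B \<longleftrightarrow> (\<exists>f. hom A B f)"

definition isomorphic :: "'r sstruct \<Rightarrow> 'r sstruct \<Rightarrow> bool" where
  "isomorphic A B \<longleftrightarrow> (\<exists>f. bij_betw f (V A) (V B) \<and>
     (\<forall>R xs. set xs \<subseteq> V A \<longrightarrow> (xs \<in> Rel A R \<longleftrightarrow> map f xs \<in> Rel B R)))"

text \<open>A set of structures represents a set of isomorphism classes when it is closed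
  under isomorphism (among well-formed structures).\<close>
definition iso_closed :: "'r set \<Rightarrow> ('r \<Rightarrow> nat) \<Rightarrow> 'r sstruct set \<Rightarrow> bool" where
  "iso_closed sig ar Ob \<longleftrightarrow> (\<forall>A B. A \<in> Ob \<longrightarrow> wf_struct sig ar B \<longrightarrow> isomorphic A B \<longrightarrow> B \<in> Ob)"

definition is_core :: "'r set \<Rightarrow> ('r \<Rightarrow> nat) \<Rightarrow> 'r sstruct \<Rightarrow> 'r sstruct \<Rightarrow> bool" where
  "is_core sig ar A C \<longleftrightarrow> wf_struct sig ar C \<and> homto A C \<and> homto C A \<and>
     (\<forall>D. wf_struct sig ar D \<longrightarrow> homto A D \<longrightarrow> homto D A \<longrightarrow> card (V C) \<le> card (V D))"

definition minimal_in :: "'r sstruct set \<Rightarrow> 'r sstruct \<Rightarrow> bool" where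
  "minimal_in Ob A \<longleftrightarrow> A \<in> Ob \<and> (\<forall>C\<in>Ob. homto C A \<longrightarrow> homto A C)"

definition inc_adj :: "'r sstruct \<Rightarrow> nat + ('r \<times> nat list) \<Rightarrow> nat + ('r \<times> nat list) \<Rightarrow> bool" where
  "inc_adj A u w \<longleftrightarrow>
     (\<exists>x R xs. xs \<in> Rel A R \<and> x \<in> set xs \<and>
        ((u = Inl x \<and> w = Inr (R, xs)) \<or> (u = Inr (R, xs) \<and> w = Inl x)))"

definition inc_has_cycle :: "'r sstruct \<Rightarrow> bool" where
  "inc_has_cycle A \<longleftrightarrow> (\<exists>cs. length cs \<ge> 3 \<and> distinct cs \<and>
     (\<forall>i < length cs. inc_adj A (cs ! i) (cs ! (Suc i mod length cs))))"

text \<open>sigma-forest: Inc(A) has no parallel edges (no repeated entry in a tuple) and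
  no cycles.\<close>
definition is_forest :: "'r set \<Rightarrow> ('r \<Rightarrow> nat) \<Rightarrow> 'r sstruct \<Rightarrow> bool" where
  "is_forest sig ar A \<longleftrightarrow> wf_struct sig ar A \<and> (\<forall>R. \<forall>xs\<in>Rel A R. distinct xs) \<and>
     \<not> inc_has_cycle A"

definition forests :: "'r set \<Rightarrow> ('r \<Rightarrow> nat) \<Rightarrow> 'r sstruct set" where
  "forests sig ar = {A. is_forest sig ar A}"

text \<open>(A,a)+(B,b): disjoint union with a and b identified (to the new root 0).\<close>
definition emb_l :: "nat \<Rightarrow> nat \<Rightarrow> nat" where
  "emb_l a x = (if x = a then 0 else 2 * x + 1)"

definition emb_r :: "nat \<Rightarrow> nat \<Rightarrow> nat" where
  "emb_r b y = (if y = b then 0 else 2 * y + 2)"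

definition glue :: "'r sstruct \<Rightarrow> nat \<Rightarrow> 'r sstruct \<Rightarrow> nat \<Rightarrow> 'r sstruct" where
  "glue A a B b = \<lparr> V = emb_l a ` V A \<union> emb_r b ` V B,
     Rel = (\<lambda>R. map (emb_l a) ` Rel A R \<union> map (emb_r b) ` Rel B R) \<rparr>"

definition residual :: "'r set \<Rightarrow> ('r \<Rightarrow> nat) \<Rightarrow> 'r sstruct set \<Rightarrow> 'r sstruct \<Rightarrow> nat
    \<Rightarrow> ('r sstruct \<times> nat) set" where
  "residual sig ar Ob A a = {(B, b). is_forest sig ar B \<and> b \<in> V B \<and> glue A a B b \<in> Ob}"

definition regular :: "'r set \<Rightarrow> ('r \<Rightarrow> nat) \<Rightarrow> 'r sstruct set \<Rightarrow> bool" where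
  "regular sig ar Ob \<longleftrightarrow>
     finite {residual sig ar Ob A a | A a. is_forest sig ar A \<and> a \<in> V A}"

end

theory Submission
  imports Defs "HOL-Library.Nat_Bijection"
begin

text \<open>A structure \<open>C\<close> is the core of a minimal element of \<open>\<O>\<close> iff some element of \<open>\<O>\<close> maps to \<open>C\<close>
  and every homomorphism from an element of \<open>\<O>\<close> to \<open>C\<close> has a section. If \<open>C\<close> is a forest, then a
  homomorphism \<open>D \<rightarrow> C\<close> has no section iff it lifts to one of finitely many structures over \<open>C\<close>,
  whose vertices over \<open>x\<close> are the blocks at \<open>x\<close>: a point over \<open>x\<close> records a direction in which no
  partial section starts. Regularity of \<open>\<O>\<close> yields a finite set of colours (sets of rooted forests
  saturated under equality of residuals) such that no nonempty element of \<open>\<O>\<close> maps to a target iff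
  the target has a good colouring. Colourability of the structures over a glued forest
  \<open>(A, a) + (B, b)\<close> depends on \<open>(A, a)\<close> only through the colours exchanged at the root, hence
  through finitely many data.\<close>


section \<open>Forests and leaf blocks\<close>

text \<open>Minimality quantifies over all of \<open>Ob\<close>, and a core is an optimum among all
  structures; sections replace both by a condition on maps into the single structure
  \<open>C\<close>. The remaining obstacle is the quantifier over these maps, which cannot be cut at
  a root. Recording directions turns the absence of a section into the existence of a map to a
  lifted target, a relative form of the classical dual of a tree; and the absence of such a map from
  \<open>Ob\<close> has a certificate, a good colouring, that can be cut at a vertex. So only the
  existence of colourings has to be followed through a glueing.

  Several features resist cutting and shape the definitions. Forests may be disconnected, so an
  obstruction sits on a union \<open>K\<close> of components, and colours are also compared in pairs
  across components. Nullary symbols touch no vertex, whence the set \<open>N\<close>. Tuples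
  supported on the root alone may belong to both sides of a glueing. Elements of \<open>Ob\<close>
  without vertices have no root and need a separate clause.\<close>

definition blocks :: "'r sstruct \<Rightarrow> ('r \<times> nat list) set" where
  "blocks A = {(R, xs). xs \<in> Rel A R}"

definition leaf_in :: "('r \<times> nat list) set \<Rightarrow> 'r \<times> nat list \<Rightarrow> nat \<Rightarrow> bool" where
  "leaf_in F e y \<longleftrightarrow> e \<in> F \<and> y \<in> set (snd e) \<and>
     (\<forall>x\<in>set (snd e). x \<noteq> y \<longrightarrow> (\<forall>f\<in>F. x \<in> set (snd f) \<longrightarrow> f = e))"

lemma leaf_inD:
  assumes "leaf_in F e y"
  shows "e \<in> F" "y \<in> set (snd e)"
    "\<And>x f. x \<in> set (snd e) \<Longrightarrow> f \<in> F \<Longrightarrow> x \<in> set (snd f) \<Longrightarrow> f \<noteq> e \<Longrightarrow> x = y"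
  using assms unfolding leaf_in_def by blast+

text \<open>Hereditary form of acyclicity: ranging over all finite subfamilies lets blocks be peeled
  off one at a time and lets the property pass to substructures. Nullary blocks are excluded because
  they have no vertex to serve as attachment point.\<close>

definition leafy :: "('r \<times> nat list) set \<Rightarrow> bool" where
  "leafy \<B> \<longleftrightarrow> (\<forall>F\<subseteq>\<B>. finite F \<longrightarrow> F \<noteq> {} \<longrightarrow> (\<forall>e\<in>F. snd e \<noteq> []) \<longrightarrow> (\<exists>e y. leaf_in F e y))"

lemma leafyD:
  assumes "leafy \<B>" "F \<subseteq> \<B>" "finite F" "F \<noteq> {}" "\<And>e. e \<in> F \<Longrightarrow> snd e \<noteq> []"
  obtains e y where "leaf_in F e y"
  using assms unfolding leafy_def by blast

lemma leafy_subset: "leafy \<B> \<Longrightarrow> \<C> \<subseteq> \<B> \<Longrightarrow> leafy \<C>"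
  unfolding leafy_def by (meson subset_trans)

text \<open>A tree has a leaf away from its root. If the leaf \<open>e\<close> found at
  \<open>y\<close> has \<open>a\<close> among its private vertices, remove \<open>e\<close> and make
  \<open>y\<close> the root of the rest. The leaf obtained there meets \<open>e\<close> at most in
  its own attachment vertex, so it is still a leaf of \<open>F\<close>, and it misses
  \<open>a\<close>, which lies on \<open>e\<close> only.\<close>

lemma leafy_rooted:
  assumes "leafy \<B>" "finite F" "F \<subseteq> \<B>" "F \<noteq> {}" "\<And>e. e \<in> F \<Longrightarrow> snd e \<noteq> []"
  shows "\<exists>e y. leaf_in F e y \<and> (a \<in> set (snd e) \<longrightarrow> a = y)"
  using assms(2-)
proof (induction "card F" arbitrary: F a rule: less_induct)
  case less
  obtain e y where ey: "leaf_in F e y"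
    using leafyD[OF assms(1) less.prems(2) less.prems(1) less.prems(3)] less.prems(4) by blast
  show ?case
  proof (cases "a \<in> set (snd e) \<and> a \<noteq> y")
    case False
    then show ?thesis using ey by blast
  next
    case True
    have eF: "e \<in> F" using ey by (simp add: leaf_in_def)
    show ?thesis
    proof (cases "F = {e}")
      case True
      then have "leaf_in F e a"
        using \<open>a \<in> set (snd e) \<and> a \<noteq> y\<close> by (auto simp: leaf_in_def)
      then show ?thesis by blast
    next
      case False
      have "card (F - {e}) < card F"
        using eF less.prems(1) by (meson card_Diff1_less)
      moreover have "F - {e} \<noteq> {}" using False eF by blast
      ultimately obtain e' y' where e': "leaf_in (F - {e}) e' y'" "y \<in> set (snd e') \<longrightarrow> y = y'"
        using less.hyps[of "F - {e}" y] less.prems by blast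
      have "leaf_in F e' y'"
        using e' ey unfolding leaf_in_def by (metis Diff_iff singletonD)
      moreover have "a \<notin> set (snd e')"
        using e'(1) ey True unfolding leaf_in_def by blast
      ultimately show ?thesis by blast
    qed
  qed
qed

section \<open>Leaf blocks versus cycles of the incidence graph\<close>

lemma cycle_from_walk:
  fixes w :: "nat \<Rightarrow> 'a"
  assumes fin: "finite (range w)"
    and adj: "\<And>k. adj (w k) (w (Suc k))"
    and ne1: "\<And>k. w (Suc k) \<noteq> w k" and ne2: "\<And>k. w (Suc (Suc k)) \<noteq> w k"
  shows "\<exists>cs. length cs \<ge> 3 \<and> distinct cs \<and> (\<forall>i<length cs. adj (cs ! i) (cs ! (Suc i mod length cs)))"
proof -
  have "\<not> inj w" using fin infinite_UNIV_nat finite_imageD by blast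
  then have ex: "\<exists>j. \<exists>i<j. w i = w j"
    unfolding inj_def by (metis linorder_neqE_nat)
  \<comment> \<open>Stopping at the first repetition makes the segment in between free of
    repetitions; \<open>ne1\<close> and \<open>ne2\<close> exclude segments of length one and
    two.\<close>
  define j where "j = (LEAST j. \<exists>i<j. w i = w j)"
  obtain i where i: "i < j" "w i = w j" using LeastI_ex[OF ex] unfolding j_def by blast
  have least: "\<And>i' j'. i' < j' \<Longrightarrow> j' < j \<Longrightarrow> w i' \<noteq> w j'"
    using not_less_Least unfolding j_def by blast
  define cs where "cs = map w [i..<j]"
  have len: "length cs = j - i" by (simp add: cs_def)
  have nth: "cs ! k = w (i + k)" if "k < j - i" for k using that by (simp add: cs_def)
  have "j \<noteq> Suc i" "j \<noteq> Suc (Suc i)" using i ne1 ne2 by metis+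
  then have l3: "length cs \<ge> 3" using i(1) len by linarith
  have "inj_on w {i..<j}"
    using least by (intro inj_onI) (metis atLeastLessThan_iff linorder_neqE_nat)
  then have "distinct cs" by (simp add: cs_def distinct_map)
  moreover have "adj (cs ! k) (cs ! (Suc k mod length cs))" if "k < length cs" for k
  proof (cases "Suc k = length cs")
    case True
    then have "cs ! (Suc k mod length cs) = w (Suc (i + k))"
      using nth[of 0] i len by (metis (no_types) add_Suc_right diff_is_0_eq less_imp_le_nat
          le_add_diff_inverse mod_self nth add_0_right not_less zero_less_diff)
    then show ?thesis using adj nth that len by metis
  next
    case False
    then have "Suc k < length cs" using that by simp
    then show ?thesis using adj[of "i + k"] nth len that by simp
  qed
  ultimately show ?thesis using l3 by blast
qed

text \<open>A finite family without a leaf can be walked through forever without turning back: a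
  block entered at \<open>y\<close> has a further vertex that lies on a further block. The walk
  \<open>w\<close> has the blocks at even positions and, at odd ones, the vertices where the next
  block is entered.\<close>

lemma acyclic_leafy:
  assumes "\<not> inc_has_cycle A"
  shows "leafy (blocks A)"
proof (rule ccontr)
  assume "\<not> leafy (blocks A)"
  then obtain F where F: "F \<subseteq> blocks A" "finite F" "F \<noteq> {}" "\<forall>e\<in>F. snd e \<noteq> []"
    and no: "\<And>e y. \<not> leaf_in F e y"
    unfolding leafy_def by blast
  define P where "P s \<longleftrightarrow> fst s \<in> F \<and> snd s \<in> set (snd (fst s))" for s :: "('a \<times> nat list) \<times> nat"
  define Q where "Q s t \<longleftrightarrow> snd t \<in> set (snd (fst s)) \<and> snd t \<noteq> snd s \<and> fst t \<noteq> fst s"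
    for s t :: "('a \<times> nat list) \<times> nat"
  obtain e0 where "e0 \<in> F" using F by blast
  moreover have "snd e0 \<noteq> []" using F(4) \<open>e0 \<in> F\<close> by blast
  ultimately have "P (e0, hd (snd e0))" by (simp add: P_def)
  then have ex0: "\<exists>s. P s" by blast
  have exs: "\<exists>t. P t \<and> Q s t" if Ps: "P s" for s
  proof -
    have "\<not> leaf_in F (fst s) (snd s)" by (rule no)
    then obtain x f where "x \<in> set (snd (fst s))" "x \<noteq> snd s" "f \<in> F" "x \<in> set (snd f)" "f \<noteq> fst s"
      using Ps unfolding leaf_in_def P_def by blast
    then have "P (f, x) \<and> Q s (f, x)" by (simp add: P_def Q_def)
    then show ?thesis by blast
  qed
  obtain s where s: "\<And>n. P (s n)" "\<And>n. Q (s n) (s (Suc n))"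
    using dependent_nat_choice[where P = "\<lambda>_. P" and Q = "\<lambda>_. Q"] ex0 exs by metis
  define w where "w i = (if even i then Inr (fst (s (i div 2))) else Inl (snd (s (Suc (i div 2)))))"
    for i :: nat
  have "range w \<subseteq> Inr ` F \<union> Inl ` (\<Union>e\<in>F. set (snd e))"
    using s(1) unfolding w_def P_def by (auto split: if_splits)
  then have fin: "finite (range w)" by (rule finite_subset) (use F(2) in auto)
  have adj: "inc_adj A (w k) (w (Suc k))" for k
  proof (cases "even k")
    case True
    let ?m = "k div 2"
    have "fst (s ?m) \<in> blocks A" using s(1) F(1) unfolding P_def by blast
    moreover have "snd (s (Suc ?m)) \<in> set (snd (fst (s ?m)))" using s(2) unfolding Q_def by blast
    ultimately show ?thesis using True
      unfolding inc_adj_def w_def blocks_def by (cases "fst (s ?m)") auto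
  next
    case False
    let ?m = "Suc (k div 2)"
    have "fst (s ?m) \<in> blocks A" using s(1) F(1) unfolding P_def by blast
    moreover have "snd (s ?m) \<in> set (snd (fst (s ?m)))" using s(1) unfolding P_def by blast
    moreover have "Suc k div 2 = ?m" using False by simp
    ultimately show ?thesis using False
      unfolding inc_adj_def w_def blocks_def by (cases "fst (s ?m)") auto
  qed
  have ne1: "w (Suc k) \<noteq> w k" for k by (simp add: w_def)
  have ne2: "w (Suc (Suc k)) \<noteq> w k" for k
    using s(2) unfolding w_def Q_def by auto
  show False
    using cycle_from_walk[of w "inc_adj A", OF fin adj ne1 ne2] assms unfolding inc_has_cycle_def
    by blast
qed

lemma inc_adj_cases:
  assumes "inc_adj A u v"
  obtains x R xs where "xs \<in> Rel A R" "x \<in> set xs" "u = Inl x" "v = Inr (R, xs)"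
  | x R xs where "xs \<in> Rel A R" "x \<in> set xs" "u = Inr (R, xs)" "v = Inl x"
  using assms unfolding inc_adj_def by blast

text \<open>A block on a cycle shares two distinct vertices with its neighbouring blocks there, so
  the blocks of a cycle form a family without a leaf.\<close>

lemma leafy_acyclic:
  assumes "leafy (blocks A)"
  shows "\<not> inc_has_cycle A"
proof
  assume "inc_has_cycle A"
  then obtain cs where cs: "length cs \<ge> 3" "distinct cs"
    "\<And>i. i < length cs \<Longrightarrow> inc_adj A (cs ! i) (cs ! (Suc i mod length cs))"
    unfolding inc_has_cycle_def by blast
  define L where "L = length cs"
  define w where "w k = cs ! (k mod L)" for k
  have L: "L \<ge> 3" "L > 0" using cs L_def by auto
  have adj: "inc_adj A (w k) (w (Suc k))" for k
    using cs(3)[of "k mod L"] L by (simp add: w_def L_def[symmetric] mod_Suc_eq)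
  have weq: "w k = w l \<longleftrightarrow> k mod L = l mod L" for k l
    using cs(2) L by (simp add: w_def nth_eq_iff_index_eq L_def)
  have ne2: "w (k + 2) \<noteq> w k" for k
  proof
    assume "w (k + 2) = w k"
    then have "L dvd (k + 2) - k" by (simp add: weq mod_eq_dvd_iff_nat)
    then show False using L by (auto dest: dvd_imp_le)
  qed
  define F where "F = {f. Inr f \<in> set cs}"
  have inset: "w k \<in> set cs" for k using L by (simp add: w_def L_def)
  \<comment> \<open>The cycle is read periodically; shifting an index by a full period leaves room
    for two predecessors without truncated subtraction.\<close>
  have surj: "\<exists>k\<ge>2. u = w k" if "u \<in> set cs" for u
  proof -
    obtain i where i: "i < L" "u = cs ! i" using \<open>u \<in> set cs\<close> by (auto simp: in_set_conv_nth L_def)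
    have "u = w (i + L)" using i by (simp add: w_def)
    then show ?thesis using L by (intro exI[of _ "i + L"]) auto
  qed
  have inF: "f \<in> F" if "w k = Inr f" for k f using inset[of k] that by (simp add: F_def)
  have blk: "f \<in> blocks A \<and> snd f \<noteq> []" if "f \<in> F" for f
  proof -
    obtain k where "Inr f = w k" using surj \<open>f \<in> F\<close> F_def by blast
    then show ?thesis using adj[of k] by (auto elim!: inc_adj_cases simp: blocks_def)
  qed
  have "finite F"
  proof -
    have "Inr ` F \<subseteq> set cs" by (auto simp: F_def)
    then show ?thesis by (meson finite_imageD finite_set finite_subset inj_Inr inj_on_subset subset_UNIV)
  qed
  moreover have "F \<noteq> {}"
    using adj[of 0] inset by (auto elim!: inc_adj_cases simp: F_def) (metis inset)+
  ultimately obtain e y where ey: "leaf_in F e y"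
    using leafyD[OF assms, of F] blk by blast
  then have "e \<in> F" by (simp add: leaf_in_def)
  then obtain k0 where "k0 \<ge> 2" "Inr e = w k0" using surj F_def by blast
  then obtain k where k: "w (k + 2) = Inr e" by (metis add.commute le_Suc_ex)
  have only: "x = y" if "x \<in> set (snd e)" "f \<in> F" "x \<in> set (snd f)" "f \<noteq> e" for x f
    using ey that unfolding leaf_in_def by blast
  obtain x1 where x1: "w (k + 1) = Inl x1" "x1 \<in> set (snd e)"
    using adj[of "k + 1"] k by (auto elim!: inc_adj_cases)
  obtain f1 where f1: "w k = Inr f1" "x1 \<in> set (snd f1)"
    using adj[of "k"] x1 by (auto elim!: inc_adj_cases)
  obtain x2 where x2: "w (k + 3) = Inl x2" "x2 \<in> set (snd e)"
    using adj[of "k + 2"] k by (auto elim!: inc_adj_cases simp: numeral_3_eq_3)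
  obtain f2 where f2: "w (k + 4) = Inr f2" "x2 \<in> set (snd f2)"
    using adj[of "k + 3"] x2 by (auto elim!: inc_adj_cases simp: eval_nat_numeral)
  have "f1 \<noteq> e" using ne2[of k] k f1 by auto
  moreover have "f2 \<noteq> e" using ne2[of "k + 2"] k f2 by (auto simp: eval_nat_numeral)
  moreover have "x1 \<noteq> x2" using ne2[of "k + 1"] x1 x2 by (auto simp: eval_nat_numeral)
  ultimately show False using only x1 f1 x2 f2 inF by metis
qed

lemma is_forest_leafy:
  "is_forest sig ar A \<longleftrightarrow> wf_struct sig ar A \<and> (\<forall>R. \<forall>xs\<in>Rel A R. distinct xs) \<and> leafy (blocks A)"
  unfolding is_forest_def using acyclic_leafy leafy_acyclic by blast


section \<open>Amalgams of rooted forests\<close>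

lemma wfD:
  assumes "wf_struct sig ar A" "xs \<in> Rel A R"
  shows "R \<in> sig" "length xs = ar R" "set xs \<subseteq> V A"
  using assms unfolding wf_struct_def by blast+

lemma wf_finite: "wf_struct sig ar A \<Longrightarrow> finite (V A)"
  by (simp add: wf_struct_def)

lemma forest_wf: "is_forest sig ar A \<Longrightarrow> wf_struct sig ar A"
  by (simp add: is_forest_def)

lemma isomorphic_sym:
  assumes "isomorphic A B"
  shows "isomorphic B A"
proof -
  obtain f where f: "bij_betw f (V A) (V B)"
    "\<And>R xs. set xs \<subseteq> V A \<Longrightarrow> xs \<in> Rel A R \<longleftrightarrow> map f xs \<in> Rel B R"
    using assms unfolding isomorphic_def by blast
  define g where "g = inv_into (V A) f"
  have g: "bij_betw g (V B) (V A)" using f(1) g_def bij_betw_inv_into by blast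
  have fg: "f (g x) = x" if "x \<in> V B" for x
    using f(1) that unfolding g_def by (simp add: bij_betw_inv_into_right)
  have "xs \<in> Rel B R \<longleftrightarrow> map g xs \<in> Rel A R" if "set xs \<subseteq> V B" for R xs
  proof -
    have "map f (map g xs) = xs" using that fg by (simp add: map_idI subset_iff)
    moreover have "set (map g xs) \<subseteq> V A" using that g by (auto simp: bij_betw_def)
    ultimately show ?thesis using f(2)[of "map g xs" R] by simp
  qed
  then show ?thesis using g unfolding isomorphic_def by blast
qed

section \<open>Images and amalgams of structures\<close>

definition img :: "(nat \<Rightarrow> nat) \<Rightarrow> 'r sstruct \<Rightarrow> 'r sstruct" where
  "img f A = \<lparr>V = f ` V A, Rel = (\<lambda>R. map f ` Rel A R)\<rparr>"

lemma isomorphic_img: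
  assumes "inj f"
  shows "isomorphic A (img f A)"
  unfolding isomorphic_def
proof (intro exI[of _ f] conjI allI impI)
  show "bij_betw f (V A) (V (img f A))"
    using assms inj_on_subset[of f UNIV] by (simp add: img_def bij_betw_def)
  show "xs \<in> Rel A R \<longleftrightarrow> map f xs \<in> Rel (img f A) R" for R xs
    using assms by (auto simp: img_def image_iff inj_map_eq_map)
qed

definition amalgam :: "'i set \<Rightarrow> ('i \<Rightarrow> 'r sstruct) \<Rightarrow> ('i \<Rightarrow> nat \<Rightarrow> nat) \<Rightarrow> 'r sstruct" where
  "amalgam I P \<phi> = \<lparr>V = (\<Union>i\<in>I. \<phi> i ` V (P i)), Rel = (\<lambda>R. \<Union>i\<in>I. map (\<phi> i) ` Rel (P i) R)\<rparr>"

text \<open>Only the pieces and the pattern of identifications matter. Later isomorphisms are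
  obtained by writing both sides as amalgams of the same pieces and comparing when two points
  coincide.\<close>

lemma isomorphic_amalgam:
  assumes sub: "\<And>i R xs. i \<in> I \<Longrightarrow> xs \<in> Rel (P i) R \<Longrightarrow> set xs \<subseteq> V (P i)"
    and ker: "\<And>i j p q. i \<in> I \<Longrightarrow> j \<in> I \<Longrightarrow> p \<in> V (P i) \<Longrightarrow> q \<in> V (P j) \<Longrightarrow>
      \<phi> i p = \<phi> j q \<longleftrightarrow> \<psi> i p = \<psi> j q"
  shows "isomorphic (amalgam I P \<phi>) (amalgam I P \<psi>)"
proof -
  define f where "f v = (SOME w. \<exists>i\<in>I. \<exists>p\<in>V (P i). v = \<phi> i p \<and> w = \<psi> i p)" for v
  have f: "f (\<phi> i p) = \<psi> i p" if "i \<in> I" "p \<in> V (P i)" for i p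
    unfolding f_def
  proof (rule some_equality)
    show "\<exists>k\<in>I. \<exists>q\<in>V (P k). \<phi> i p = \<phi> k q \<and> \<psi> i p = \<psi> k q" using that by blast
    show "w = \<psi> i p" if "\<exists>k\<in>I. \<exists>q\<in>V (P k). \<phi> i p = \<phi> k q \<and> w = \<psi> k q" for w
      using that ker[OF \<open>i \<in> I\<close> _ \<open>p \<in> V (P i)\<close>] by metis
  qed
  have mapf: "map f (map (\<phi> i) ys) = map (\<psi> i) ys" if "i \<in> I" "ys \<in> Rel (P i) R" for i ys R
    using f that sub by fastforce
  have inj: "inj_on f (V (amalgam I P \<phi>))"
    using ker by (auto simp: amalgam_def inj_on_def f)
  show ?thesis
    unfolding isomorphic_def
  proof (intro exI[of _ f] conjI allI impI)
    have "f ` V (amalgam I P \<phi>) = V (amalgam I P \<psi>)"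
      by (auto simp: amalgam_def f image_UN image_image)
    then show "bij_betw f (V (amalgam I P \<phi>)) (V (amalgam I P \<psi>))"
      using inj by (simp add: bij_betw_def)
    fix R and xs :: "nat list" assume xs: "set xs \<subseteq> V (amalgam I P \<phi>)"
    show "xs \<in> Rel (amalgam I P \<phi>) R \<longleftrightarrow> map f xs \<in> Rel (amalgam I P \<psi>) R"
    proof
      assume "xs \<in> Rel (amalgam I P \<phi>) R"
      then obtain i ys where "i \<in> I" "ys \<in> Rel (P i) R" "xs = map (\<phi> i) ys"
        by (auto simp: amalgam_def)
      then show "map f xs \<in> Rel (amalgam I P \<psi>) R"
        using mapf by (auto simp: amalgam_def simp del: map_map)
    next
      assume "map f xs \<in> Rel (amalgam I P \<psi>) R"
      then obtain i ys where i: "i \<in> I" "ys \<in> Rel (P i) R" "map f xs = map (\<psi> i) ys"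
        by (auto simp: amalgam_def)
      then have "map f xs = map f (map (\<phi> i) ys)" using mapf by simp
      moreover have "set (map (\<phi> i) ys) \<subseteq> V (amalgam I P \<phi>)"
        using i sub by (fastforce simp: amalgam_def)
      ultimately have "xs = map (\<phi> i) ys"
        using xs inj map_inj_on[of f xs "map (\<phi> i) ys"] by (metis Un_least inj_on_subset)
      then show "xs \<in> Rel (amalgam I P \<phi>) R" using i by (auto simp: amalgam_def)
    qed
  qed
qed

lemma emb_eq [simp]:
  "emb_l a x = emb_l a y \<longleftrightarrow> x = y" "emb_r b x = emb_r b y \<longleftrightarrow> x = y"
  "emb_l a x = emb_r b y \<longleftrightarrow> x = a \<and> y = b" "emb_r b y = emb_l a x \<longleftrightarrow> x = a \<and> y = b"
  by (auto simp: emb_l_def emb_r_def split: if_splits) presburger+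

lemma inj_emb [simp]: "inj (emb_l a)" "inj (emb_r b)"
  by (simp_all add: inj_def)

definition pr :: "nat \<Rightarrow> nat \<Rightarrow> nat" where
  "pr x z = prod_encode (x, z)"

lemma pr_eq [simp]: "pr x z = pr x' z' \<longleftrightarrow> x = x' \<and> z = z'"
  by (simp add: pr_def)

text \<open>\<open>Tot D E\<close> hangs the rooted structure \<open>E x\<close> at every vertex \<open>x\<close> of \<open>D\<close>; the vertex \<open>x\<close>
  itself becomes \<open>root_at E x\<close>.\<close>

definition root_at :: "(nat \<Rightarrow> 'r sstruct \<times> nat) \<Rightarrow> nat \<Rightarrow> nat" where
  "root_at E x = pr x (snd (E x))"

definition Tot :: "'r sstruct \<Rightarrow> (nat \<Rightarrow> 'r sstruct \<times> nat) \<Rightarrow> 'r sstruct" where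
  "Tot D E = \<lparr>V = (\<Union>x\<in>V D. pr x ` V (fst (E x))),
     Rel = (\<lambda>R. map (root_at E) ` Rel D R \<union> (\<Union>x\<in>V D. map (pr x) ` Rel (fst (E x)) R))\<rparr>"

definition rforests :: "'r set \<Rightarrow> ('r \<Rightarrow> nat) \<Rightarrow> ('r sstruct \<times> nat) set" where
  "rforests sig ar = {(E, e). is_forest sig ar E \<and> e \<in> V E}"

lemma rforestsD:
  assumes "p \<in> rforests sig ar"
  shows "is_forest sig ar (fst p)" "wf_struct sig ar (fst p)" "snd p \<in> V (fst p)"
  using assms by (auto simp: rforests_def is_forest_def)

section \<open>Forests are closed under glueing and under hanging branches\<close>

lemma leaf_in_lift:
  assumes "inj \<phi>" and F': "F' = {f \<in> blocks A. (fst f, map \<phi> (snd f)) \<in> F}"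
    and leaf: "leaf_in F' e y"
    and only: "\<And>x f. x \<in> set (snd e) \<Longrightarrow> x \<noteq> y \<Longrightarrow> f \<in> F \<Longrightarrow> \<phi> x \<in> set (snd f) \<Longrightarrow>
      \<exists>f0\<in>blocks A. f = (fst f0, map \<phi> (snd f0))"
  shows "leaf_in F (fst e, map \<phi> (snd e)) (\<phi> y)"
  unfolding leaf_in_def
proof (intro conjI ballI impI)
  show "(fst e, map \<phi> (snd e)) \<in> F" "\<phi> y \<in> set (snd (fst e, map \<phi> (snd e)))"
    using leaf F' by (auto simp: leaf_in_def)
  fix x' f assume x': "x' \<in> set (snd (fst e, map \<phi> (snd e)))" "x' \<noteq> \<phi> y" and f: "f \<in> F" "x' \<in> set (snd f)"
  then obtain x where x: "x \<in> set (snd e)" "x' = \<phi> x" "x \<noteq> y" by auto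
  then obtain f0 where f0: "f0 \<in> blocks A" "f = (fst f0, map \<phi> (snd f0))"
    using only f by blast
  then have "f0 \<in> F'" using F' f by simp
  moreover have "x \<in> set (snd f0)" using f f0 x assms(1) by (auto simp: inj_def)
  ultimately have "f0 = e" using leaf x unfolding leaf_in_def by blast
  then show "f = (fst e, map \<phi> (snd e))" using f0 by simp
qed

lemma finite_lift:
  assumes "inj \<phi>" "finite F"
  shows "finite {f \<in> \<B>. (fst f, map \<phi> (snd f)) \<in> F}"
proof -
  have "inj (\<lambda>f. (fst f, map \<phi> (snd f)))"
    using assms(1) by (auto simp: inj_def prod_eq_iff inj_map_eq_map)
  then have "finite ((\<lambda>f. (fst f, map \<phi> (snd f))) -` F)"
    using assms(2) finite_vimageI by blast
  then show ?thesis by (rule finite_subset[rotated]) auto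
qed

text \<open>Within one piece of a composite structure only the attachment vertex \<open>a\<close>
  can lie on blocks of other pieces. Rooting the piece at \<open>a\<close> yields a leaf that does
  not have \<open>a\<close> as a private vertex, and such a leaf survives in the whole.\<close>

lemma leaf_lift_ex:
  assumes "inj \<phi>" "leafy (blocks A)" "finite F" "\<And>f. f \<in> F \<Longrightarrow> snd f \<noteq> []"
    and ex: "f1 \<in> blocks A" "(fst f1, map \<phi> (snd f1)) \<in> F"
    and only: "\<And>x f. x \<noteq> a \<Longrightarrow> f \<in> F \<Longrightarrow> \<phi> x \<in> set (snd f) \<Longrightarrow>
      \<exists>f0\<in>blocks A. f = (fst f0, map \<phi> (snd f0))"
  shows "\<exists>e y. leaf_in F e y"
proof -
  let ?F = "{f \<in> blocks A. (fst f, map \<phi> (snd f)) \<in> F}"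
  have "\<And>f. f \<in> ?F \<Longrightarrow> snd f \<noteq> []" using assms(4) by fastforce
  moreover have "?F \<noteq> {}" using ex by blast
  ultimately obtain e y where ey: "leaf_in ?F e y" "a \<in> set (snd e) \<longrightarrow> a = y"
    using leafy_rooted[OF assms(2), of ?F a] finite_lift[OF assms(1,3), of "blocks A"] by blast
  have "leaf_in F (fst e, map \<phi> (snd e)) (\<phi> y)"
  proof (rule leaf_in_lift[OF assms(1) refl ey(1)])
    fix x f assume h: "x \<in> set (snd e)" "x \<noteq> y" "f \<in> F" "\<phi> x \<in> set (snd f)"
    then have "x \<noteq> a" using ey(2) by blast
    then show "\<exists>f0\<in>blocks A. f = (fst f0, map \<phi> (snd f0))" using only h by blast
  qed
  then show ?thesis by blast
qed

lemma is_forest_glue: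
  assumes A: "is_forest sig ar A" "a \<in> V A" and B: "is_forest sig ar B" "b \<in> V B"
  shows "is_forest sig ar (glue A a B b)"
proof -
  have wA: "wf_struct sig ar A" and wB: "wf_struct sig ar B" using A B forest_wf by auto
  have "wf_struct sig ar (glue A a B b)"
    unfolding wf_struct_def
  proof (intro conjI allI ballI impI)
    show "finite (V (glue A a B b))"
      using wA wB by (simp add: glue_def wf_struct_def)
    show "Rel (glue A a B b) R = {}" if "R \<notin> sig" for R
      using wA wB that by (simp add: glue_def wf_struct_def)
    fix R xs assume "xs \<in> Rel (glue A a B b) R"
    then consider ys where "ys \<in> Rel A R" "xs = map (emb_l a) ys"
      | ys where "ys \<in> Rel B R" "xs = map (emb_r b) ys"
      by (auto simp: glue_def)
    then have "length xs = ar R \<and> set xs \<subseteq> V (glue A a B b)"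
    proof cases
      case (1 ys)
      then show ?thesis using wfD(2,3)[OF wA 1(1)] by (auto simp: glue_def)
    next
      case (2 ys)
      then show ?thesis using wfD(2,3)[OF wB 2(1)] by (auto simp: glue_def)
    qed
    then show "length xs = ar R" "set xs \<subseteq> V (glue A a B b)" by auto
  qed
  moreover have "distinct xs" if "xs \<in> Rel (glue A a B b) R" for R xs
    using that A B by (auto simp: glue_def is_forest_def distinct_map inj_on_def)
  moreover have "leafy (blocks (glue A a B b))"
    unfolding leafy_def
  proof (intro allI impI)
    fix F assume F: "F \<subseteq> blocks (glue A a B b)" "finite F" "F \<noteq> {}" "\<forall>e\<in>F. snd e \<noteq> []"
    have cases: "(\<exists>f0\<in>blocks A. f = (fst f0, map (emb_l a) (snd f0))) \<or>
      (\<exists>f0\<in>blocks B. f = (fst f0, map (emb_r b) (snd f0)))" if "f \<in> F" for f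
    proof -
      obtain R xs where f: "f = (R, xs)" by force
      then have "xs \<in> Rel (glue A a B b) R" using F(1) that by (auto simp: blocks_def)
      then consider ys where "ys \<in> Rel A R" "xs = map (emb_l a) ys"
        | ys where "ys \<in> Rel B R" "xs = map (emb_r b) ys"
        by (auto simp: glue_def)
      then show ?thesis
      proof cases
        case (1 ys)
        then show ?thesis using f by (intro disjI1 bexI[of _ "(R, ys)"]) (auto simp: blocks_def)
      next
        case (2 ys)
        then show ?thesis using f by (intro disjI2 bexI[of _ "(R, ys)"]) (auto simp: blocks_def)
      qed
    qed
    show "\<exists>e y. leaf_in F e y"
    proof (cases "\<exists>f0\<in>blocks A. (fst f0, map (emb_l a) (snd f0)) \<in> F")
      case True
      then obtain f1 where "f1 \<in> blocks A" "(fst f1, map (emb_l a) (snd f1)) \<in> F" by blast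
      then show ?thesis
      proof (rule leaf_lift_ex[OF inj_emb(1) _ F(2), where a = a, rotated 2])
        show "leafy (blocks A)" using A by (simp add: is_forest_leafy)
        fix x f assume "x \<noteq> a" "f \<in> F" "emb_l a x \<in> set (snd f)"
        then show "\<exists>f0\<in>blocks A. f = (fst f0, map (emb_l a) (snd f0))"
          using cases[of f] by auto
      qed (use F(4) in blast)+
    next
      case False
      obtain f where "f \<in> F" using F by blast
      then obtain f1 where "f1 \<in> blocks B" "(fst f1, map (emb_r b) (snd f1)) \<in> F"
        using cases[of f] False by auto
      then show ?thesis
      proof (rule leaf_lift_ex[OF inj_emb(2) _ F(2), where a = b, rotated 2])
        show "leafy (blocks B)" using B by (simp add: is_forest_leafy)
        fix x f assume "f \<in> F"
        then show "\<exists>f0\<in>blocks B. f = (fst f0, map (emb_r b) (snd f0))"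
          using cases[of f] False by auto
      qed (use F(4) in blast)+
    qed
  qed
  ultimately show ?thesis by (simp add: is_forest_leafy)
qed

lemma inj_pr: "inj (pr x)" and inj_root_at: "inj (root_at E)"
  by (auto simp: inj_def root_at_def)

lemma root_at_in_Tot: "j \<in> V D \<Longrightarrow> snd (E j) \<in> V (fst (E j)) \<Longrightarrow> root_at E j \<in> V (Tot D E)"
  by (auto simp: Tot_def root_at_def)

lemma wf_Tot:
  assumes D: "wf_struct sig ar D" and E: "\<And>x. x \<in> V D \<Longrightarrow> wf_struct sig ar (fst (E x)) \<and> snd (E x) \<in> V (fst (E x))"
  shows "wf_struct sig ar (Tot D E)"
  unfolding wf_struct_def
proof (intro conjI allI ballI impI)
  show "finite (V (Tot D E))"
    using D E by (simp add: Tot_def wf_struct_def)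
  show "Rel (Tot D E) R = {}" if "R \<notin> sig" for R
    using D E that by (simp add: Tot_def wf_struct_def)
  fix R xs assume "xs \<in> Rel (Tot D E) R"
  then consider ys where "ys \<in> Rel D R" "xs = map (root_at E) ys"
    | x ys where "x \<in> V D" "ys \<in> Rel (fst (E x)) R" "xs = map (pr x) ys"
    by (auto simp: Tot_def)
  then have "length xs = ar R \<and> set xs \<subseteq> V (Tot D E)"
  proof cases
    case 1
    then show ?thesis using wfD[OF D 1(1)] E root_at_in_Tot[of _ D E] by auto
  next
    case 2
    then show ?thesis using wfD[of sig ar "fst (E x)" ys R] E[of x] by (auto simp: Tot_def)
  qed
  then show "length xs = ar R" "set xs \<subseteq> V (Tot D E)" by auto
qed

lemma is_forest_Tot:
  assumes D: "is_forest sig ar D" and E: "\<And>x. x \<in> V D \<Longrightarrow> E x \<in> rforests sig ar"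
  shows "is_forest sig ar (Tot D E)"
proof -
  have "wf_struct sig ar (Tot D E)"
    using wf_Tot[OF forest_wf[OF D]] E rforestsD by metis
  moreover have "distinct xs" if xs: "xs \<in> Rel (Tot D E) R" for R xs
  proof -
    have "distinct (map (pr x) ys) \<longleftrightarrow> distinct ys" "distinct (map (root_at E) ys) \<longleftrightarrow> distinct ys" for x ys
      using inj_pr inj_root_at by (metis distinct_map inj_on_subset subset_UNIV)+
    moreover consider ys where "ys \<in> Rel D R" "xs = map (root_at E) ys"
      | x ys where "x \<in> V D" "ys \<in> Rel (fst (E x)) R" "xs = map (pr x) ys"
      using xs by (auto simp: Tot_def)
    ultimately show ?thesis
      using D E rforestsD(1) unfolding is_forest_def by metis
  qed
  moreover have "leafy (blocks (Tot D E))"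
    unfolding leafy_def
  proof (intro allI impI)
    fix F assume F: "F \<subseteq> blocks (Tot D E)" "finite F" "F \<noteq> {}" "\<forall>e\<in>F. snd e \<noteq> []"
    have cases: "(\<exists>f0\<in>blocks D. f = (fst f0, map (root_at E) (snd f0))) \<or>
      (\<exists>x\<in>V D. \<exists>f0\<in>blocks (fst (E x)). f = (fst f0, map (pr x) (snd f0)))" if "f \<in> F" for f
    proof -
      obtain R xs where f: "f = (R, xs)" by force
      then have "xs \<in> Rel (Tot D E) R" using F(1) that by (auto simp: blocks_def)
      then consider ys where "ys \<in> Rel D R" "xs = map (root_at E) ys"
        | x ys where "x \<in> V D" "ys \<in> Rel (fst (E x)) R" "xs = map (pr x) ys"
        by (auto simp: Tot_def)
      then show ?thesis
      proof cases
        case (1 ys)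
        then show ?thesis using f by (intro disjI1 bexI[of _ "(R, ys)"]) (auto simp: blocks_def)
      next
        case (2 x ys)
        then show ?thesis using f
          by (intro disjI2 bexI[of _ x] bexI[of _ "(R, ys)"]) (auto simp: blocks_def)
      qed
    qed
    show "\<exists>e y. leaf_in F e y"
    proof (cases "\<exists>x\<in>V D. \<exists>f0\<in>blocks (fst (E x)). (fst f0, map (pr x) (snd f0)) \<in> F")
      case True
      then obtain x f1 where x: "x \<in> V D" and f1: "f1 \<in> blocks (fst (E x))" "(fst f1, map (pr x) (snd f1)) \<in> F"
        by blast
      from f1 show ?thesis
      proof (rule leaf_lift_ex[OF inj_pr _ F(2), where a = "snd (E x)", rotated 2])
        show "leafy (blocks (fst (E x)))" using E[OF x] rforestsD(1) is_forest_leafy by blast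
        fix z f assume "z \<noteq> snd (E x)" "f \<in> F" "pr x z \<in> set (snd f)"
        then show "\<exists>f0\<in>blocks (fst (E x)). f = (fst f0, map (pr x) (snd f0))"
          using cases[of f] by (fastforce simp: root_at_def)
      qed (use F(4) in blast)+
    next
      case False
      obtain f where "f \<in> F" using F by blast
      then obtain f1 where "f1 \<in> blocks D" "(fst f1, map (root_at E) (snd f1)) \<in> F"
        using cases[of f] False by auto
      then show ?thesis
      proof (rule leaf_lift_ex[OF inj_root_at _ F(2), rotated 2])
        show "leafy (blocks D)" using D by (simp add: is_forest_leafy)
        fix x f assume "f \<in> F"
        then show "\<exists>f0\<in>blocks D. f = (fst f0, map (root_at E) (snd f0))"
          using cases[of f] False by auto
      qed (use F(4) in blast)+
    qed
  qed
  ultimately show ?thesis by (simp add: is_forest_leafy)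
qed

definition pt :: "'r sstruct" where
  "pt = \<lparr>V = {0}, Rel = (\<lambda>_. {})\<rparr>"

lemma pt_simps [simp]: "V pt = {0}" "Rel pt R = {}"
  by (simp_all add: pt_def)

lemma is_forest_discrete:
  assumes "finite (V D)" "\<And>R. Rel D R = {}"
  shows "is_forest sig ar D"
  using assms by (auto simp: is_forest_leafy wf_struct_def leafy_def blocks_def)

lemma pt_rforest: "(pt, 0) \<in> rforests sig ar"
  by (simp add: rforests_def is_forest_discrete)

lemma isomorphic_Tot_pt:
  fixes D :: "'r sstruct"
  shows "isomorphic D (Tot D (\<lambda>_. (pt, 0)))"
proof -
  have "root_at (\<lambda>_. (pt :: 'r sstruct, 0)) = (\<lambda>x. pr x 0)" by (simp add: root_at_def fun_eq_iff)
  then have "Tot D (\<lambda>_. (pt, 0)) = img (\<lambda>x. pr x 0) D"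
    by (auto simp: Tot_def img_def root_at_def)
  then show ?thesis using isomorphic_img[of "\<lambda>x. pr x 0" D] by (simp add: inj_def)
qed

lemma isomorphic_Tot_singleton:
  assumes "V D = {x}" "\<And>R. Rel D R = {}"
  shows "isomorphic (fst (E x)) (Tot D E)"
proof -
  have "Tot D E = img (pr x) (fst (E x))"
    using assms by (auto simp: Tot_def img_def)
  then show ?thesis using isomorphic_img[OF inj_pr] by metis
qed

lemma isomorphic_glue_pt:
  assumes "e \<in> V E"
  shows "isomorphic E (glue E e pt 0)"
proof -
  have "glue E e pt 0 = img (emb_l e) E"
    using assms by (auto simp: glue_def img_def emb_l_def emb_r_def)
  then show ?thesis using isomorphic_img[OF inj_emb(1)] by metis
qed


section \<open>Isomorphisms between amalgams\<close>

text \<open>Displays the branch at \<open>x\<close> as one operand of a glueing whose other operand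
  is all the rest; membership in \<open>Ob\<close> then depends on \<open>E x\<close> only through
  its residual. Both sides are amalgams of \<open>F\<close>, \<open>D\<close> and the branches,
  indexed by \<open>None\<close>, \<open>Some None\<close> and \<open>Some (Some u)\<close>.\<close>

lemma isomorphic_replace:
  assumes D: "wf_struct sig ar D" "x \<in> V D" "j \<in> V D"
    and E: "\<And>u. u \<in> V D \<Longrightarrow> wf_struct sig ar (fst (E u)) \<and> snd (E u) \<in> V (fst (E u))"
    and F: "wf_struct sig ar F" "f \<in> V F"
  defines "E' \<equiv> E(x := (pt, 0))"
  shows "isomorphic (glue (Tot D E) (root_at E j) F f)
    (glue (fst (E x)) (snd (E x)) (glue (Tot D E') (root_at E' j) F f) (emb_l (root_at E' j) (pr x 0)))"
    (is "isomorphic ?W1 ?W2")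
proof -
  define z z' where "z = root_at E j" and "z' = root_at E' j"
  define w where "w = emb_l z' (pr x 0)"
  define I where "I = insert None (insert (Some None) ((\<lambda>u. Some (Some u)) ` V D))"
  define P where "P i = (case i of None \<Rightarrow> F | Some None \<Rightarrow> D | Some (Some u) \<Rightarrow> fst (E u))" for i
  define \<phi> where "\<phi> i = (case i of None \<Rightarrow> emb_r f | Some None \<Rightarrow> (\<lambda>u. emb_l z (root_at E u))
     | Some (Some u) \<Rightarrow> (\<lambda>p. emb_l z (pr u p)))" for i
  define \<psi> where "\<psi> i = (case i of None \<Rightarrow> (\<lambda>q. emb_r w (emb_r f q))
     | Some None \<Rightarrow> (\<lambda>u. emb_r w (emb_l z' (root_at E' u)))
     | Some (Some u) \<Rightarrow> (if u = x then emb_l (snd (E x)) else (\<lambda>p. emb_r w (emb_l z' (pr u p)))))" for i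
  have "\<And>u. u \<in> V D \<Longrightarrow> snd (E u) \<in> V (fst (E u))" using E by blast
  then have rootV: "root_at E ` V D \<subseteq> (\<Union>u\<in>V D. pr u ` V (fst (E u)))"
    by (auto simp: root_at_def)
  have "amalgam I P \<phi> = ?W1"
  proof (rule sstruct.equality)
    have "V (amalgam I P \<phi>) = emb_r f ` V F \<union> emb_l z ` (root_at E ` V D \<union> (\<Union>u\<in>V D. pr u ` V (fst (E u))))"
      by (simp add: amalgam_def I_def P_def \<phi>_def image_UN image_Un image_image)
    also have "\<dots> = V ?W1"
      using rootV by (simp add: glue_def Tot_def Un_absorb1 z_def Un_commute)
    finally show "V (amalgam I P \<phi>) = V ?W1" .
    show "Rel (amalgam I P \<phi>) = Rel ?W1"
      by (simp add: amalgam_def I_def P_def \<phi>_def glue_def Tot_def z_def fun_eq_iff image_UN image_Un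
          image_image Un_ac comp_def)
  qed simp
  moreover have "amalgam I P \<psi> = ?W2"
  proof (rule sstruct.equality)
    let ?r = "\<lambda>v. emb_r w (emb_l z' v)"
    have spl: "(\<Union>u\<in>V D. g u) = g x \<union> (\<Union>u\<in>V D - {x}. g u)" for g :: "nat \<Rightarrow> 'b set"
      using D(2) by blast
    have Edash: "E' x = (pt, 0)" "\<And>u. u \<in> V D - {x} \<Longrightarrow> E' u = E u" by (auto simp: E'_def)
    have ps: "\<And>u. u \<in> V D - {x} \<Longrightarrow> \<psi> (Some (Some u)) = (\<lambda>p. ?r (pr u p))"
      "\<psi> (Some (Some x)) = emb_l (snd (E x))" "\<psi> None = (\<lambda>q. emb_r w (emb_r f q))"
      "\<psi> (Some None) = (\<lambda>u. ?r (root_at E' u))"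
      by (auto simp: \<psi>_def)
    have U1: "(\<Union>u\<in>V D. \<psi> (Some (Some u)) ` V (fst (E u))) =
        emb_l (snd (E x)) ` V (fst (E x)) \<union> ?r ` (\<Union>u\<in>V D - {x}. pr u ` V (fst (E' u)))"
      by (subst spl) (simp add: ps Edash image_UN image_image)
    have U2: "(\<Union>u\<in>V D. pr u ` V (fst (E' u))) = {pr x 0} \<union> (\<Union>u\<in>V D - {x}. pr u ` V (fst (E' u)))"
      by (subst spl) (simp add: Edash)
    \<comment> \<open>The point of the placeholder \<open>pt\<close> at \<open>x\<close> is
      identified with the root of \<open>E x\<close>, so it contributes no vertex of its
      own.\<close>
    have x0: "?r (pr x 0) \<in> emb_l (snd (E x)) ` V (fst (E x))"
      using E[OF D(2)] by (force simp: w_def emb_r_def emb_l_def[of "snd (E x)"])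
    define X where "X = emb_l (snd (E x)) ` V (fst (E x))"
    define Y where "Y = (\<Union>u\<in>V D - {x}. pr u ` V (fst (E' u)))"
    define Z where "Z = ?r ` root_at E' ` V D"
    have "root_at E' ` V D \<subseteq> (\<Union>u\<in>V D. pr u ` V (fst (E' u)))"
      using E by (auto simp: root_at_def E'_def)
    from image_mono[OF this, of ?r] have "Z \<subseteq> insert (?r (pr x 0)) (?r ` Y)"
      unfolding U2 Y_def[symmetric] Z_def by simp
    then have rt: "Z \<union> (X \<union> ?r ` Y) = X \<union> ?r ` insert (pr x 0) Y"
      using x0 unfolding X_def[symmetric] image_insert by auto
    have "V (amalgam I P \<psi>) = (\<lambda>q. emb_r w (emb_r f q)) ` V F \<union> (Z \<union>
        (\<Union>u\<in>V D. \<psi> (Some (Some u)) ` V (fst (E u))))"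
      by (simp add: amalgam_def I_def P_def ps image_image Z_def)
    also have "\<dots> = (\<lambda>q. emb_r w (emb_r f q)) ` V F \<union> (X \<union> ?r ` insert (pr x 0) Y)"
      unfolding U1 X_def[symmetric] Y_def[symmetric] rt ..
    also have "\<dots> = V ?W2"
      by (simp add: glue_def Tot_def U2 w_def[symmetric] z'_def[symmetric] image_Un image_image X_def Y_def Un_ac)
    finally show "V (amalgam I P \<psi>) = V ?W2" .
    show "Rel (amalgam I P \<psi>) = Rel ?W2"
    proof
      fix R
      have U1: "(\<Union>u\<in>V D. map (\<psi> (Some (Some u))) ` Rel (fst (E u)) R) =
        map (emb_l (snd (E x))) ` Rel (fst (E x)) R \<union> map ?r ` (\<Union>u\<in>V D - {x}. map (pr u) ` Rel (fst (E' u)) R)"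
        by (subst spl) (simp add: ps Edash image_UN image_image comp_def)
      have U2: "(\<Union>u\<in>V D. map (pr u) ` Rel (fst (E' u)) R) = (\<Union>u\<in>V D - {x}. map (pr u) ` Rel (fst (E' u)) R)"
        by (subst spl) (simp add: Edash)
      show "Rel (amalgam I P \<psi>) R = Rel ?W2 R"
        using U1 by (simp add: amalgam_def I_def P_def ps glue_def Tot_def U2 z'_def[symmetric] w_def[symmetric]
            image_Un image_image comp_def Un_ac)
    qed
  qed simp
  moreover have "isomorphic (amalgam I P \<phi>) (amalgam I P \<psi>)"
  proof (rule isomorphic_amalgam)
    show "set xs \<subseteq> V (P i)" if "i \<in> I" "xs \<in> Rel (P i) R" for i R xs
      using that D(1) E F(1) wfD(3) unfolding I_def P_def by (fastforce split: option.splits)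
    show "\<phi> i p = \<phi> k q \<longleftrightarrow> \<psi> i p = \<psi> k q"
      if "i \<in> I" "k \<in> I" "p \<in> V (P i)" "q \<in> V (P k)" for i k p q
      by (cases i; cases k; cases "the i"; cases "the k")
        (auto simp: \<phi>_def \<psi>_def z_def z'_def w_def root_at_def E'_def)
  qed
  ultimately show ?thesis by simp
qed

text \<open>The part \<open>D\<^sub>0\<close> of \<open>D\<close> on the vertices \<open>xs\<close> is contracted to the vertex \<open>xs ! j\<close>.\<close>

lemma isomorphic_contract:
  assumes D: "wf_struct sig ar D" and D0: "wf_struct sig ar D0" "V D0 = {..<length xs}"
    and D': "wf_struct sig ar D'" "V D' = V D - (set xs - {xs ! j})"
    and xs: "distinct xs" "set xs \<subseteq> V D" "j < length xs"
    and Rel: "\<And>R. Rel D R = Rel D' R \<union> map ((!) xs) ` Rel D0 R"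
    and E: "\<And>u. u \<in> V D \<Longrightarrow> wf_struct sig ar (fst (E u)) \<and> snd (E u) \<in> V (fst (E u))"
  defines "E0 \<equiv> \<lambda>i. E (xs ! i)"
  shows "isomorphic (Tot D E) (Tot D' (E(xs ! j := (Tot D0 E0, root_at E0 j))))"
    (is "isomorphic ?W1 ?W2")
proof -
  define y where "y = xs ! j"
  define E' where "E' = E(y := (Tot D0 E0, root_at E0 j))"
  define idx where "idx = inv_into {..<length xs} ((!) xs)"
  have inj: "inj_on ((!) xs) {..<length xs}" using xs(1) by (simp add: inj_on_nth)
  have idx: "idx (xs ! i) = i" if "i < length xs" for i
    using that inj by (simp add: idx_def)
  have setxs: "set xs = (!) xs ` {..<length xs}" by (auto simp: set_conv_nth)
  have y: "y \<in> set xs" "y \<in> V D" "y \<in> V D'" using xs D'(2) by (auto simp: y_def)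
  define I where "I = insert None (insert (Some None) ((\<lambda>u. Some (Some u)) ` V D))"
  define P where "P i = (case i of None \<Rightarrow> D0 | Some None \<Rightarrow> D' | Some (Some u) \<Rightarrow> fst (E u))" for i
  define \<phi> where "\<phi> i = (case i of None \<Rightarrow> (\<lambda>k. root_at E (xs ! k)) | Some None \<Rightarrow> root_at E
     | Some (Some u) \<Rightarrow> pr u)" for i
  define \<psi> where "\<psi> i = (case i of None \<Rightarrow> (\<lambda>k. pr y (root_at E0 k)) | Some None \<Rightarrow> root_at E'
     | Some (Some u) \<Rightarrow> (if u \<in> set xs then (\<lambda>p. pr y (pr (idx u) p)) else pr u))" for i
  have VD: "V D = set xs \<union> (V D' - {y})" using xs D'(2) y_def by auto
  have disj: "u \<notin> set xs" if "u \<in> V D' - {y}" for u using that D'(2) y_def by auto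
  have splD: "(\<Union>u\<in>V D. g u) = (\<Union>i\<in>{..<length xs}. g (xs ! i)) \<union> (\<Union>u\<in>V D' - {y}. g u)" for g :: "nat \<Rightarrow> 'b set"
    unfolding VD setxs by auto
  have splD': "(\<Union>u\<in>V D'. g u) = g y \<union> (\<Union>u\<in>V D' - {y}. g u)" for g :: "nat \<Rightarrow> 'b set"
    using y by blast
  have Edash: "E' y = (Tot D0 E0, root_at E0 j)" "\<And>u. u \<in> V D' - {y} \<Longrightarrow> E' u = E u" by (auto simp: E'_def)
  have ps: "\<And>u. u \<in> V D' - {y} \<Longrightarrow> \<psi> (Some (Some u)) = pr u"
    "\<And>i. i < length xs \<Longrightarrow> \<psi> (Some (Some (xs ! i))) = (\<lambda>p. pr y (pr i p))"
    "\<psi> None = (\<lambda>k. pr y (root_at E0 k))" "\<psi> (Some None) = root_at E'"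
    using disj idx by (auto simp: \<psi>_def)
  have "amalgam I P \<phi> = ?W1"
  proof (rule sstruct.equality)
    have "(\<lambda>k. root_at E (xs ! k)) ` {..<length xs} \<subseteq> (\<Union>u\<in>V D. pr u ` V (fst (E u)))"
      "root_at E ` V D' \<subseteq> (\<Union>u\<in>V D. pr u ` V (fst (E u)))"
      using E D'(2) xs(2) by (fastforce simp: root_at_def)+
    then show "V (amalgam I P \<phi>) = V ?W1"
      by (auto simp: amalgam_def I_def P_def \<phi>_def Tot_def D0(2))
    show "Rel (amalgam I P \<phi>) = Rel ?W1"
      by (simp add: amalgam_def I_def P_def \<phi>_def Tot_def fun_eq_iff Rel image_Un image_image comp_def Un_ac)
  qed simp
  moreover have "amalgam I P \<psi> = ?W2"
  proof (rule sstruct.equality)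
    have U1: "(\<Union>u\<in>V D. \<psi> (Some (Some u)) ` V (fst (E u))) = (\<Union>u\<in>V D'. pr u ` V (fst (E' u)))"
      by (subst splD, subst splD') (simp add: ps Edash Tot_def D0(2) E0_def image_UN image_image)
    have "(\<lambda>k. pr y (root_at E0 k)) ` {..<length xs} \<subseteq> (\<Union>u\<in>V D'. pr u ` V (fst (E' u)))"
    proof -
      have "root_at E0 k \<in> V (Tot D0 E0)" if "k < length xs" for k
        using root_at_in_Tot[of k D0 E0] D0(2) xs E that by (simp add: E0_def subset_iff)
      then show ?thesis unfolding splD' Edash(1) by auto
    qed
    moreover have "root_at E' ` V D' \<subseteq> (\<Union>u\<in>V D'. pr u ` V (fst (E' u)))"
    proof -
      have "snd (E' u) \<in> V (fst (E' u))" if "u \<in> V D'" for u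
      proof (cases "u = y")
        case True
        have "root_at E0 j \<in> V (Tot D0 E0)"
          using root_at_in_Tot[of j D0 E0] D0(2) xs E by (simp add: E0_def subset_iff)
        then show ?thesis using True Edash by simp
      next
        case False
        then show ?thesis using that Edash E D'(2) by simp
      qed
      then show ?thesis by (auto simp: root_at_def)
    qed
    ultimately show "V (amalgam I P \<psi>) = V ?W2"
      using U1 by (auto simp: amalgam_def I_def P_def ps Tot_def[of D'] D0(2) E'_def[symmetric] y_def[symmetric])
    show "Rel (amalgam I P \<psi>) = Rel ?W2"
    proof
      fix R
      have U1: "(\<Union>u\<in>V D. map (\<psi> (Some (Some u))) ` Rel (fst (E u)) R) \<union> map (\<lambda>k. pr y (root_at E0 k)) ` Rel D0 R
          = (\<Union>u\<in>V D'. map (pr u) ` Rel (fst (E' u)) R)"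
        by (subst splD, subst splD')
          (simp add: ps Edash Tot_def D0(2) E0_def image_UN image_Un image_image comp_def Un_ac)
      then show "Rel (amalgam I P \<psi>) R = Rel ?W2 R"
        by (simp add: amalgam_def I_def P_def ps Tot_def[of D'] E'_def[symmetric] y_def[symmetric] Un_ac)
    qed
  qed simp
  moreover have "isomorphic (amalgam I P \<phi>) (amalgam I P \<psi>)"
  proof (rule isomorphic_amalgam)
    show "set zs \<subseteq> V (P i)" if "i \<in> I" "zs \<in> Rel (P i) R" for i R zs
      using that D0(1) D'(1) E wfD(3) unfolding I_def P_def by (fastforce split: option.splits)
    have rE: "root_at E' u = (if u = y then pr y (root_at E0 j) else root_at E u)" for u
      by (simp add: root_at_def E'_def)
    have ids: "idx u < length xs" "xs ! idx u = u" if "u \<in> set xs" for u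
      using that idx by (auto simp: in_set_conv_nth)
    \<comment> \<open>Every point of a piece has coordinates: a vertex \<open>u\<close> of
      \<open>D\<close> and a point \<open>z\<close> of the branch there. On the contracted side
      \<open>h\<close> encodes the same coordinates, so comparing identifications comes down to the
      injectivity of \<open>h\<close>.\<close>
    define h where "h u z = (if u \<in> set xs then pr y (pr (idx u) z) else pr u z)" for u z
    have coord: "\<exists>u\<in>V D. \<exists>z. \<phi> i p = pr u z \<and> \<psi> i p = h u z" if "i \<in> I" "p \<in> V (P i)" for i p
    proof -
      consider "i = None" | "i = Some None" | u where "i = Some (Some u)" "u \<in> V D"
        using \<open>i \<in> I\<close> unfolding I_def by blast
      then show ?thesis
      proof cases
        case 1
        then have "p < length xs" using that D0(2) by (simp add: P_def)
        then show ?thesis using 1 xs(2) idx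
          by (intro bexI[of _ "xs ! p"] exI[of _ "snd (E (xs ! p))"])
            (auto simp: \<phi>_def \<psi>_def h_def root_at_def E0_def)
      next
        case 2
        then have p: "p \<in> V D'" using that by (simp add: P_def)
        have "idx y = j" "E0 j = E y" using idx[OF xs(3)] by (simp_all add: y_def E0_def)
        then have "root_at E' p = h p (snd (E p))"
          using y(1) disj[of p] p unfolding rE h_def by (cases "p = y") (simp_all add: root_at_def)
        moreover have "p \<in> V D" using p D'(2) by simp
        ultimately show ?thesis using 2
          by (intro bexI[of _ p] exI[of _ "snd (E p)"]) (simp_all add: \<phi>_def \<psi>_def root_at_def)
      next
        case 3
        then show ?thesis by (intro bexI[of _ u] exI[of _ p]) (auto simp: \<phi>_def \<psi>_def h_def)
      qed
    qed
    have "pr u z = pr u' z' \<longleftrightarrow> h u z = h u' z'" for u u' z z'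
    proof -
      have "idx u = idx u' \<longleftrightarrow> u = u'" if "u \<in> set xs" "u' \<in> set xs"
        using that ids(2) by metis
      moreover have "u' \<noteq> y" if "u' \<notin> set xs" for u' using that y(1) by blast
      ultimately show ?thesis unfolding h_def by simp metis
    qed
    then show "\<phi> i p = \<phi> k q \<longleftrightarrow> \<psi> i p = \<psi> k q"
      if "i \<in> I" "k \<in> I" "p \<in> V (P i)" "q \<in> V (P k)" for i k p q
      using coord[OF that(1,3)] coord[OF that(2,4)] by metis
  qed
  ultimately show ?thesis by (simp add: E'_def y_def)
qed


section \<open>A duality for regular classes\<close>

lemma Tot_cong:
  assumes "wf_struct sig ar D" "\<And>x. x \<in> V D \<Longrightarrow> E x = F x"
  shows "Tot D E = Tot D F"
proof -
  have "map (root_at E) xs = map (root_at F) xs" if "xs \<in> Rel D R" for xs R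
    using wfD(3)[OF assms(1) that] assms(2) by (auto simp: root_at_def)
  then have "map (root_at E) ` Rel D R = map (root_at F) ` Rel D R" for R
    by (intro image_cong) auto
  moreover have "(\<Union>x\<in>V D. map (pr x) ` Rel (fst (E x)) R) = (\<Union>x\<in>V D. map (pr x) ` Rel (fst (F x)) R)" for R
    using assms(2) by auto
  moreover have "(\<Union>x\<in>V D. pr x ` V (fst (E x))) = (\<Union>x\<in>V D. pr x ` V (fst (F x)))"
    using assms(2) by auto
  ultimately show ?thesis unfolding Tot_def by simp
qed

lemma Tot_rforest:
  assumes "is_forest sig ar D" "j \<in> V D" and E: "\<And>x. x \<in> V D \<Longrightarrow> E x \<in> rforests sig ar"
  shows "(Tot D E, root_at E j) \<in> rforests sig ar"
proof -
  have "is_forest sig ar (Tot D E)" using is_forest_Tot assms by blast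
  moreover have "root_at E j \<in> V (Tot D E)"
    using root_at_in_Tot[of j D E] rforestsD(3)[OF E] assms(2) by blast
  ultimately show ?thesis by (simp add: rforests_def)
qed

lemma finite_blocks:
  assumes "finite sig" "wf_struct sig ar A"
  shows "finite (blocks A)"
proof (rule finite_subset)
  show "blocks A \<subseteq> (SIGMA R:sig. {xs. set xs \<subseteq> V A \<and> length xs = ar R})"
    using wfD[OF assms(2)] unfolding blocks_def by blast
  show "finite (SIGMA R:sig. {xs. set xs \<subseteq> V A \<and> length xs = ar R})"
    using assms wf_finite by (intro finite_SigmaI finite_lists_length_eq) auto
qed

lemma is_forest_sub:
  assumes "is_forest sig ar D" "wf_struct sig ar D'" "\<And>R. Rel D' R \<subseteq> Rel D R"
  shows "is_forest sig ar D'"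
proof -
  have "blocks D' \<subseteq> blocks D" using assms(3) by (auto simp: blocks_def)
  then show ?thesis using assms leafy_subset unfolding is_forest_leafy by blast
qed

text \<open>Two parameters, because a nullary block still needs a vertex to be rooted at: the cases
  in use are \<open>edge R n n\<close>, a single block, and \<open>edge R 1 0\<close>, a point
  carrying a nullary tuple.\<close>

definition edge :: "'r \<Rightarrow> nat \<Rightarrow> nat \<Rightarrow> 'r sstruct" where
  "edge R m n = \<lparr>V = {..<m}, Rel = (\<lambda>R'. if R' = R then {[0..<n]} else {})\<rparr>"

definition two_points :: "'r sstruct" where
  "two_points = \<lparr>V = {..<2}, Rel = (\<lambda>_. {})\<rparr>"

lemma edge_simps [simp]: "V (edge R m n) = {..<m}" "Rel (edge R m n) R' = (if R' = R then {[0..<n]} else {})"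
  and two_points_simps [simp]: "V two_points = {..<2}" "Rel two_points R' = {}"
  by (simp_all add: edge_def two_points_def)

lemma is_forest_edge:
  assumes "R \<in> sig" "ar R = n" "n \<le> m"
  shows "is_forest sig ar (edge R m n)"
proof -
  have "leaf_in F (R, [0..<n]) 0" if "F \<subseteq> blocks (edge R m n)" "F \<noteq> {}" "\<forall>e\<in>F. snd e \<noteq> []" for F
  proof -
    have "blocks (edge R m n) = {(R, [0..<n])}" by (auto simp: blocks_def split: if_splits)
    then have "F = {(R, [0..<n])}" using that by auto
    then show ?thesis using that by (auto simp: leaf_in_def)
  qed
  then have "leafy (blocks (edge R m n))" unfolding leafy_def by blast
  then show ?thesis using assms by (auto simp: is_forest_leafy wf_struct_def)
qed

section \<open>Closure conditions on sets of rooted forests\<close>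

definition hom_into :: "'r sstruct \<Rightarrow> 'h set \<Rightarrow> ('r \<Rightarrow> 'h list set) \<Rightarrow> (nat \<Rightarrow> 'h) \<Rightarrow> bool" where
  "hom_into D VH RH k \<longleftrightarrow> k ` V D \<subseteq> VH \<and> (\<forall>R. \<forall>xs\<in>Rel D R. map k xs \<in> RH R)"

text \<open>The branch \<open>E j\<close> stays in place at the new root \<open>j\<close>. Closure
  under a single block therefore already comprises adding that block, with the branches at its other
  vertices, to a given rooted forest.\<close>

definition closed_under :: "'r sstruct \<Rightarrow> (nat \<Rightarrow> ('r sstruct \<times> nat) set) \<Rightarrow> bool" where
  "closed_under D c \<longleftrightarrow> (\<forall>E. (\<forall>x\<in>V D. E x \<in> c x) \<longrightarrow> (\<forall>j\<in>V D. (Tot D E, root_at E j) \<in> c j))"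

lemma closed_under_cong:
  assumes "\<And>x. x \<in> V D \<Longrightarrow> c x = c' x"
  shows "closed_under D c \<longleftrightarrow> closed_under D c'"
  using assms unfolding closed_under_def by metis

definition tuple_ok :: "'r \<Rightarrow> ('r sstruct \<times> nat) set list \<Rightarrow> bool" where
  "tuple_ok R Ss \<longleftrightarrow> closed_under (edge R (length Ss) (length Ss)) ((!) Ss)"

text \<open>Forests may be disconnected: this is the step that puts another component beside a
  rooted forest.\<close>

definition pair_ok :: "('r sstruct \<times> nat) set \<Rightarrow> ('r sstruct \<times> nat) set \<Rightarrow> bool" where
  "pair_ok S T \<longleftrightarrow> closed_under two_points (\<lambda>i. if i = 0 then S else T)"

definition nullary_ok :: "'r \<Rightarrow> ('r sstruct \<times> nat) set \<Rightarrow> bool" where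
  "nullary_ok R S \<longleftrightarrow> closed_under (edge R 1 0) (\<lambda>_. S)"

locale forest_class =
  fixes sig :: "'r set" and ar :: "'r \<Rightarrow> nat" and Ob :: "'r sstruct set"
  assumes finite_sig: "finite sig" and Ob_forests: "Ob \<subseteq> forests sig ar"
    and Ob_iso: "iso_closed sig ar Ob"
begin

lemma ObD: "A \<in> Ob \<Longrightarrow> is_forest sig ar A"
  using Ob_forests by (auto simp: forests_def)

lemma Ob_isomorphic:
  assumes "wf_struct sig ar A" "wf_struct sig ar B" "isomorphic A B"
  shows "A \<in> Ob \<longleftrightarrow> B \<in> Ob"
  using assms Ob_iso isomorphic_sym unfolding iso_closed_def by blast

abbreviation RF :: "('r sstruct \<times> nat) set" where
  "RF \<equiv> rforests sig ar"

abbreviation res :: "'r sstruct \<times> nat \<Rightarrow> ('r sstruct \<times> nat) set" where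
  "res p \<equiv> residual sig ar Ob (fst p) (snd p)"

lemma glue_Tot_in_Ob:
  assumes D: "is_forest sig ar D" "x \<in> V D" "j \<in> V D" and E: "\<And>u. u \<in> V D \<Longrightarrow> E u \<in> RF"
    and F: "is_forest sig ar F" "f \<in> V F"
  defines "E' \<equiv> E(x := (pt, 0))"
  shows "glue (Tot D E) (root_at E j) F f \<in> Ob \<longleftrightarrow>
    (glue (Tot D E') (root_at E' j) F f, emb_l (root_at E' j) (pr x 0)) \<in> res (E x)"
proof -
  have E'RF: "\<And>u. u \<in> V D \<Longrightarrow> E' u \<in> RF" using E pt_rforest[of sig ar] by (simp add: E'_def)
  have f1: "is_forest sig ar (glue (Tot D E) (root_at E j) F f)"
    by (intro is_forest_glue is_forest_Tot root_at_in_Tot D F E rforestsD(3)[OF E[OF D(3)]])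
  have f2: "is_forest sig ar (glue (Tot D E') (root_at E' j) F f)"
    by (intro is_forest_glue is_forest_Tot root_at_in_Tot D F E'RF rforestsD(3)[OF E'RF[OF D(3)]])
  have "pr x 0 \<in> V (Tot D E')" using D(2) by (force simp: Tot_def E'_def)
  then have r2: "emb_l (root_at E' j) (pr x 0) \<in> V (glue (Tot D E') (root_at E' j) F f)"
    by (simp add: glue_def)
  have f3: "is_forest sig ar (glue (fst (E x)) (snd (E x)) (glue (Tot D E') (root_at E' j) F f)
      (emb_l (root_at E' j) (pr x 0)))"
    using is_forest_glue[OF _ _ f2 r2] rforestsD[OF E[OF D(2)]] by blast
  have "\<And>u. u \<in> V D \<Longrightarrow> wf_struct sig ar (fst (E u)) \<and> snd (E u) \<in> V (fst (E u))"
    using E rforestsD by blast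
  then have "isomorphic (glue (Tot D E) (root_at E j) F f) (glue (fst (E x)) (snd (E x))
      (glue (Tot D E') (root_at E' j) F f) (emb_l (root_at E' j) (pr x 0)))"
    using isomorphic_replace[OF forest_wf[OF D(1)] D(2,3) _ forest_wf[OF F(1)] F(2)]
    unfolding E'_def by blast
  then have "glue (Tot D E) (root_at E j) F f \<in> Ob \<longleftrightarrow> glue (fst (E x)) (snd (E x))
      (glue (Tot D E') (root_at E' j) F f) (emb_l (root_at E' j) (pr x 0)) \<in> Ob"
    using Ob_isomorphic f1 f3 forest_wf by blast
  then show ?thesis using f2 r2 by (simp add: residual_def)
qed

lemma residual_Tot_upd:
  assumes D: "is_forest sig ar D" "x \<in> V D" "j \<in> V D" and E: "\<And>u. u \<in> V D \<Longrightarrow> E u \<in> RF"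
    and q: "q \<in> RF" "res (E x) = res q"
  shows "res (Tot D E, root_at E j) = res (Tot D (E(x := q)), root_at (E(x := q)) j)"
proof -
  have Eq: "(E(x := q)) u \<in> RF" if "u \<in> V D" for u using E q that by simp
  have "glue (Tot D E) (root_at E j) F f \<in> Ob \<longleftrightarrow> glue (Tot D (E(x := q))) (root_at (E(x := q)) j) F f \<in> Ob"
    if "is_forest sig ar F" "f \<in> V F" for F f
    using glue_Tot_in_Ob[where E = E, OF D E that] glue_Tot_in_Ob[where E = "E(x := q)", OF D Eq that] q(2)
    by simp
  then show ?thesis unfolding residual_def by auto
qed

text \<open>Equality of residuals is a congruence for hanging branches. The branches are exchanged
  one vertex at a time, the remainder of the structure acting as the test forest for the one being
  exchanged; \<open>G S\<close> has been exchanged on \<open>S\<close>.\<close>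

lemma residual_Tot:
  assumes D: "is_forest sig ar D" "j \<in> V D" and E: "\<And>u. u \<in> V D \<Longrightarrow> E u \<in> RF"
    and F: "\<And>u. u \<in> V D \<Longrightarrow> F u \<in> RF" and eq: "\<And>u. u \<in> V D \<Longrightarrow> res (E u) = res (F u)"
  shows "res (Tot D E, root_at E j) = res (Tot D F, root_at F j)"
proof -
  define G where "G S u = (if u \<in> S then F u else E u)" for S u
  have "finite (V D)" using D(1) forest_wf wf_finite by blast
  have "res (Tot D E, root_at E j) = res (Tot D (G S), root_at (G S) j)" if "finite S" "S \<subseteq> V D" for S
    using that
  proof (induction S rule: finite_induct)
    case empty
    have "G {} = E" by (simp add: G_def fun_eq_iff)
    then show ?case by simp
  next
    case (insert x S)
    have upd: "G (insert x S) = (G S)(x := F x)" by (simp add: G_def fun_eq_iff)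
    have "\<And>u. u \<in> V D \<Longrightarrow> G S u \<in> RF" using E F by (simp add: G_def)
    moreover have "res (G S x) = res (F x)" using insert eq by (simp add: G_def)
    ultimately have "res (Tot D (G S), root_at (G S) j) =
        res (Tot D (G (insert x S)), root_at (G (insert x S)) j)"
      unfolding upd using insert.prems F by (intro residual_Tot_upd[OF D(1) _ D(2)]) auto
    then show ?case using insert by simp
  qed
  then have "res (Tot D E, root_at E j) = res (Tot D (G (V D)), root_at (G (V D)) j)"
    using \<open>finite (V D)\<close> by blast
  moreover have "Tot D (G (V D)) = Tot D F"
    by (rule Tot_cong[OF forest_wf[OF D(1)]]) (simp add: G_def)
  moreover have "root_at (G (V D)) j = root_at F j" using D(2) by (simp add: root_at_def G_def)
  ultimately show ?thesis by simp
qed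

text \<open>Saturation makes a colour a union of classes of equal residual, hence leaves finitely
  many colours when \<open>Ob\<close> is regular. The single point belongs to each colour so that an
  induction over a coloured forest can start from bare vertices.\<close>

definition colour :: "('r sstruct \<times> nat) set \<Rightarrow> bool" where
  "colour S \<longleftrightarrow> S \<subseteq> RF \<and> (\<forall>p\<in>S. \<forall>q\<in>RF. res q = res p \<longrightarrow> q \<in> S) \<and> (pt, 0) \<in> S \<and> (\<forall>p\<in>S. fst p \<notin> Ob)"

lemma finite_colours:
  assumes "regular sig ar Ob"
  shows "finite {S. colour S}"
proof (rule finite_subset)
  have "res ` RF = {residual sig ar Ob A a |A a. is_forest sig ar A \<and> a \<in> V A}"
    by (force simp: rforests_def image_iff)
  then have "finite (res ` RF)" using assms by (simp add: regular_def)
  then show "finite ((\<lambda>Z. {p \<in> RF. res p \<in> Z}) ` Pow (res ` RF))" by simp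
  show "{S. colour S} \<subseteq> (\<lambda>Z. {p \<in> RF. res p \<in> Z}) ` Pow (res ` RF)"
  proof
    fix S assume "S \<in> {S. colour S}"
    then have S: "S \<subseteq> RF" "\<And>p q. p \<in> S \<Longrightarrow> q \<in> RF \<Longrightarrow> res q = res p \<Longrightarrow> q \<in> S"
      by (auto simp: colour_def)
    then have "S = {p \<in> RF. res p \<in> res ` S}" by blast
    then show "S \<in> (\<lambda>Z. {p \<in> RF. res p \<in> Z}) ` Pow (res ` RF)" using S(1) by blast
  qed
qed

text \<open>Only the last condition refers to the position of colours in a tuple. For given nullary
  symbols, the pair and nullary conditions depend just on the set of colours in use, which is how
  they survive an exchange of one side of a glueing.\<close>

definition good :: "('h \<Rightarrow> ('r sstruct \<times> nat) set) \<Rightarrow> 'h set \<Rightarrow> ('r \<Rightarrow> 'h list set) \<Rightarrow> bool" where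
  "good c VH RH \<longleftrightarrow> (\<forall>h\<in>VH. colour (c h)) \<and> (\<forall>h\<in>VH. \<forall>h'\<in>VH. pair_ok (c h) (c h')) \<and>
     (\<forall>R. [] \<in> RH R \<longrightarrow> (\<forall>h\<in>VH. nullary_ok R (c h))) \<and>
     (\<forall>R. \<forall>hs\<in>RH R. hs \<noteq> [] \<longrightarrow> tuple_ok R (map c hs))"

lemma good_hom:
  assumes "good c VH RH" "hom_into D VH RH k"
  shows "good (c \<circ> k) (V D) (Rel D)"
proof -
  have k: "\<And>x. x \<in> V D \<Longrightarrow> k x \<in> VH" "\<And>R xs. xs \<in> Rel D R \<Longrightarrow> map k xs \<in> RH R"
    using assms(2) by (auto simp: hom_into_def)
  have "[] \<in> RH R" if "[] \<in> Rel D R" for R using k(2)[OF that] by simp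
  moreover have "tuple_ok R (map (c \<circ> k) xs)" if "xs \<in> Rel D R" "xs \<noteq> []" for R xs
  proof -
    have "tuple_ok R (map c (map k xs))"
      using assms(1) k(2)[OF that(1)] that(2) unfolding good_def by blast
    then show ?thesis by simp
  qed
  ultimately show ?thesis using assms(1) k(1) unfolding good_def by simp
qed

lemma good_Tot_notin_Ob:
  assumes "is_forest sig ar D" "V D \<noteq> {}" "good c (V D) (Rel D)" "\<And>x. x \<in> V D \<Longrightarrow> E x \<in> c x"
  shows "Tot D E \<notin> Ob"
  using assms
proof (induction "card (V D) + card (blocks D)" arbitrary: D E rule: less_induct)
  case less
  have wf_D: "wf_struct sig ar D" using less.prems(1) forest_wf by blast
  have finV: "finite (V D)" and finB: "finite (blocks D)"
    using wf_D wf_finite finite_blocks finite_sig by blast+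
  have cRF: "S \<subseteq> RF" if "colour S" for S using that by (simp add: colour_def)
  have c: "\<And>x. x \<in> V D \<Longrightarrow> colour (c x)" using less.prems(3) by (simp add: good_def)
  have ERF: "\<And>x. x \<in> V D \<Longrightarrow> E x \<in> RF" using c cRF less.prems(4) by blast
  have contract: ?case
    if D0: "is_forest sig ar D0" "V D0 = {..<length xs}"
      and D': "wf_struct sig ar D'" "V D' = V D - (set xs - {xs ! j})"
      and xs: "distinct xs" "set xs \<subseteq> V D" "j < length xs"
      and Rel: "\<And>R. Rel D R = Rel D' R \<union> map ((!) xs) ` Rel D0 R"
      and less': "card (V D') + card (blocks D') < card (V D) + card (blocks D)"
      and cl: "closed_under D0 (\<lambda>i. c (xs ! i))"
    for D0 D' xs j
  proof -
    define E0 where "E0 i = E (xs ! i)" for i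
    define E' where "E' = E(xs ! j := (Tot D0 E0, root_at E0 j))"
    have "\<And>i. i < length xs \<Longrightarrow> xs ! i \<in> V D" using xs(2) by auto
    then have "(Tot D0 E0, root_at E0 j) \<in> c (xs ! j)"
      using cl D0(2) xs(3) less.prems(4) unfolding closed_under_def E0_def by simp
    then have E'c: "E' x \<in> c x" if "x \<in> V D'" for x
      using that less.prems(4) D'(2) by (simp add: E'_def)
    have sub: "V D' \<subseteq> V D" "\<And>R. Rel D' R \<subseteq> Rel D R" using D'(2) Rel by auto
    have "is_forest sig ar D'" using is_forest_sub less.prems(1) D'(1) sub(2) by blast
    moreover have "xs ! j \<in> V D'" using D'(2) xs by auto
    moreover have "good c (V D') (Rel D')" using less.prems(3) sub unfolding good_def by blast
    ultimately have "Tot D' E' \<notin> Ob" using less.hyps[OF less'] E'c by blast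
    moreover have "isomorphic (Tot D E) (Tot D' E')"
      unfolding E'_def E0_def
      by (rule isomorphic_contract[OF wf_D forest_wf[OF D0(1)] D0(2) D' xs Rel])
        (use ERF rforestsD in blast)+
    moreover have "wf_struct sig ar (Tot D E)"
      using wf_Tot[OF wf_D] ERF rforestsD by metis
    moreover have "wf_struct sig ar (Tot D' E')"
    proof (rule wf_Tot[OF D'(1)])
      fix x assume "x \<in> V D'"
      then have "E' x \<in> RF" using E'c c cRF sub(1) by blast
      then show "wf_struct sig ar (fst (E' x)) \<and> snd (E' x) \<in> V (fst (E' x))"
        using rforestsD by blast
    qed
    ultimately show ?thesis using Ob_isomorphic by blast
  qed
  consider (nullary) R where "[] \<in> Rel D R" | (block) "blocks D \<noteq> {}" "\<And>e. e \<in> blocks D \<Longrightarrow> snd e \<noteq> []"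
    | (two) x x' where "blocks D = {}" "x \<in> V D" "x' \<in> V D" "x \<noteq> x'" | (one) x where "blocks D = {}" "V D = {x}"
    using less.prems(2) unfolding blocks_def by fastforce
  then show ?case
  proof cases
    case nullary
    obtain x where x: "x \<in> V D" using less.prems(2) by blast
    define D' where "D' = D\<lparr>Rel := (\<lambda>R'. Rel D R' - (if R' = R then {[]} else {}))\<rparr>"
    have "blocks D' = blocks D - {(R, [])}" by (auto simp: D'_def blocks_def split: if_splits)
    moreover have "(R, []) \<in> blocks D" using nullary by (simp add: blocks_def)
    ultimately have "card (blocks D') < card (blocks D)" using finB by (metis card_Diff1_less)
    moreover have "ar R = 0" "R \<in> sig" using wfD[OF wf_D nullary] by auto
    moreover have "nullary_ok R (c x)" using less.prems(3) nullary x unfolding good_def by blast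
    then have "closed_under (edge R 1 0) (\<lambda>i. c ([x] ! i))"
      unfolding nullary_ok_def by (subst closed_under_cong[where c' = "\<lambda>_. c x"]) auto
    ultimately show ?thesis
      using wf_D x nullary
      by (intro contract[of "edge R 1 0" "[x]" D' 0] is_forest_edge)
        (auto simp: D'_def wf_struct_def split: if_splits)
  next
    case block
    have lf: "leafy (blocks D)" using less.prems(1) by (simp add: is_forest_leafy)
    obtain e y where ey: "leaf_in (blocks D) e y"
      by (rule leafyD[OF lf subset_refl finB block(1)]) (use block(2) in auto)
    obtain R xs where e: "e = (R, xs)" by force
    have xs: "xs \<in> Rel D R" "y \<in> set xs" using leaf_inD(1,2)[OF ey] e by (auto simp: blocks_def)
    then have "xs \<noteq> []" by auto
    have only: "x = y" if "x \<in> set xs" "zs \<in> Rel D R'" "x \<in> set zs" "(R', zs) \<noteq> (R, xs)" for x zs R'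
      using leaf_inD(3)[OF ey, of x "(R', zs)"] that by (simp add: e blocks_def)
    obtain j where j: "j < length xs" "xs ! j = y" using xs(2) by (auto simp: in_set_conv_nth)
    define D' where "D' = \<lparr>V = V D - (set xs - {y}), Rel = (\<lambda>R'. Rel D R' - (if R' = R then {xs} else {}))\<rparr>"
    have wf': "wf_struct sig ar D'"
      unfolding wf_struct_def
    proof (intro conjI allI impI ballI)
      fix R' zs assume "zs \<in> Rel D' R'"
      then have zs: "zs \<in> Rel D R'" "(R', zs) \<noteq> (R, xs)" by (auto simp: D'_def split: if_splits)
      then show "length zs = ar R'" "set zs \<subseteq> V D'"
        using wfD[OF wf_D zs(1)] only[OF _ zs(1) _ zs(2)] by (auto simp: D'_def)
    qed (use wf_D in \<open>auto simp: D'_def wf_struct_def\<close>)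
    have "blocks D' = blocks D - {e}" by (auto simp: D'_def blocks_def e split: if_splits)
    moreover have "e \<in> blocks D" using xs by (simp add: blocks_def e)
    ultimately have "card (blocks D') < card (blocks D)" using finB by (metis card_Diff1_less)
    moreover have "card (V D') \<le> card (V D)" using finV by (auto simp: D'_def intro: card_mono)
    ultimately have smaller: "card (V D') + card (blocks D') < card (V D) + card (blocks D)" by simp
    have dist: "distinct xs" using less.prems(1) xs(1) by (simp add: is_forest_def)
    have R: "R \<in> sig" "ar R = length xs" "set xs \<subseteq> V D" using wfD[OF wf_D xs(1)] by auto
    have "tuple_ok R (map c xs)" using less.prems(3) xs \<open>xs \<noteq> []\<close> unfolding good_def by blast
    then have cl: "closed_under (edge R (length xs) (length xs)) (\<lambda>i. c (xs ! i))"
      unfolding tuple_ok_def by (subst closed_under_cong[where c' = "(!) (map c xs)"]) auto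
    have RelD: "Rel D R' = Rel D' R' \<union> map ((!) xs) ` Rel (edge R (length xs) (length xs)) R'" for R'
      using xs(1) by (auto simp: D'_def map_nth)
    have D0: "is_forest sig ar (edge R (length xs) (length xs))"
      by (rule is_forest_edge[where ar = ar]) (use R in simp_all)
    show ?thesis
      by (rule contract[OF D0 edge_simps(1) wf' _ dist R(3) j(1) RelD smaller cl])
        (simp_all add: D'_def j(2))
  next
    case two
    define D' :: "'r sstruct" where "D' = \<lparr>V = V D - {x'}, Rel = (\<lambda>_. {})\<rparr>"
    have "Rel D R = {}" for R using two(1) by (auto simp: blocks_def)
    then have RelD: "Rel D R = Rel D' R \<union> map ((!) [x, x']) ` Rel two_points R" for R
      by (simp add: D'_def)
    have "V D' \<subset> V D" using two by (auto simp: D'_def)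
    then have "card (V D') < card (V D)" using finV by (rule psubset_card_mono[rotated])
    then have smaller: "card (V D') + card (blocks D') < card (V D) + card (blocks D)"
      by (simp add: D'_def blocks_def)
    have pair: "pair_ok (c x) (c x')" using less.prems(3) two(2,3) unfolding good_def by blast
    have eq: "c ([x, x'] ! i) = (if i = 0 then c x else c x')" if "i \<in> V two_points" for i
      using that by (auto simp: less_2_cases_iff)
    have cl: "closed_under two_points (\<lambda>i. c ([x, x'] ! i))"
      using pair unfolding pair_ok_def by (subst closed_under_cong[OF eq])
    have D0: "is_forest sig ar two_points" by (rule is_forest_discrete) simp_all
    have wf': "wf_struct sig ar D'" using finV by (simp add: D'_def wf_struct_def)
    show ?thesis
      by (rule contract[OF D0 _ wf' _ _ _ _ RelD smaller cl, of 0]) (use two in \<open>auto simp: D'_def\<close>)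
  next
    case one
    then have "isomorphic (fst (E x)) (Tot D E)"
      by (intro isomorphic_Tot_singleton) (auto simp: blocks_def)
    moreover have "fst (E x) \<notin> Ob" using c[of x] less.prems(4)[of x] one by (auto simp: colour_def)
    moreover have "wf_struct sig ar (fst (E x))" "wf_struct sig ar (Tot D E)"
      using ERF one rforestsD(2) wf_Tot[OF wf_D] rforestsD by (metis singletonI)+
    ultimately show ?thesis using Ob_isomorphic by blast
  qed
qed

lemma good_notin_Ob:
  assumes "good c VH RH" "hom_into D VH RH k" "is_forest sig ar D" "V D \<noteq> {}"
  shows "D \<notin> Ob"
proof -
  have g: "good (c \<circ> k) (V D) (Rel D)" using good_hom assms by blast
  have "(pt, 0) \<in> (c \<circ> k) x" if "x \<in> V D" for x
    using g that by (simp add: good_def colour_def)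
  then have "Tot D (\<lambda>_. (pt, 0)) \<notin> Ob" by (intro good_Tot_notin_Ob[OF assms(3,4) g])
  moreover have "wf_struct sig ar (Tot D (\<lambda>_. (pt, 0)))"
    using wf_Tot[OF forest_wf[OF assms(3)]] rforestsD[OF pt_rforest] by metis
  ultimately show ?thesis using Ob_isomorphic[OF forest_wf[OF assms(3)]] isomorphic_Tot_pt by blast
qed

text \<open>Rooted forests that map to the target with the root going to \<open>h\<close>, saturated
  so as to have a chance of being a colour.\<close>

definition canonical :: "'h set \<Rightarrow> ('r \<Rightarrow> 'h list set) \<Rightarrow> 'h \<Rightarrow> ('r sstruct \<times> nat) set" where
  "canonical VH RH h = {q \<in> RF. \<exists>p\<in>RF. res q = res p \<and> (\<exists>k. hom_into (fst p) VH RH k \<and> k (snd p) = h)}"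

lemma canonicalE:
  assumes "q \<in> canonical VH RH h"
  obtains p k where "q \<in> RF" "p \<in> RF" "res q = res p" "hom_into (fst p) VH RH k" "k (snd p) = h"
  using assms unfolding canonical_def by blast

lemma canonicalI:
  assumes "q \<in> RF" "(D, d) \<in> RF" "res q = res (D, d)" "hom_into D VH RH k" "k d = h"
  shows "q \<in> canonical VH RH h"
  unfolding canonical_def using assms by (intro CollectI conjI bexI[of _ "(D, d)"] exI[of _ k]) auto

text \<open>Representatives that really map to the target have homomorphisms agreeing with
  \<open>l\<close> at their roots, so these combine to one on the whole of \<open>Tot D E\<close>.
  The congruence \<open>residual_Tot\<close> carries the result over to the given branches
  \<open>F\<close>.\<close>

lemma closed_under_canonical:
  assumes D: "is_forest sig ar D" and l: "hom_into D VH RH l"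
  shows "closed_under D (\<lambda>x. canonical VH RH (l x))"
  unfolding closed_under_def
proof (intro allI impI ballI)
  fix F j assume F: "\<forall>x\<in>V D. F x \<in> canonical VH RH (l x)" and j: "j \<in> V D"
  then have "\<forall>x\<in>V D. \<exists>p k. F x \<in> RF \<and> p \<in> RF \<and> res (F x) = res p \<and> hom_into (fst p) VH RH k \<and> k (snd p) = l x"
    by (metis canonicalE)
  then obtain E k where Ek: "\<forall>x\<in>V D. F x \<in> RF \<and> E x \<in> RF \<and> res (F x) = res (E x) \<and>
      hom_into (fst (E x)) VH RH (k x) \<and> k x (snd (E x)) = l x"
    by metis
  define m where "m v = (let (x, z) = prod_decode v in k x z)" for v
  have m: "m (pr x z) = k x z" for x z by (simp add: m_def pr_def)
  have "hom_into (Tot D E) VH RH m"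
    unfolding hom_into_def
  proof (intro conjI allI ballI)
    show "m ` V (Tot D E) \<subseteq> VH"
      using Ek unfolding hom_into_def Tot_def by (simp add: m image_UN image_image UN_subset_iff image_subset_iff)
    fix R xs assume "xs \<in> Rel (Tot D E) R"
    then consider ys where "ys \<in> Rel D R" "xs = map (root_at E) ys"
      | x ys where "x \<in> V D" "ys \<in> Rel (fst (E x)) R" "xs = map (pr x) ys"
      by (auto simp: Tot_def)
    then show "map m xs \<in> RH R"
    proof cases
      case 1
      have "map m xs = map l ys"
        using 1 Ek wfD(3)[OF forest_wf[OF D] 1(1)] by (auto simp: root_at_def m)
      then show ?thesis using l 1(1) unfolding hom_into_def by metis
    next
      case 2
      have "map m xs = map (k x) ys" using 2 by (simp add: m)
      then show ?thesis using Ek 2(1,2) unfolding hom_into_def by metis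
    qed
  qed
  moreover have "m (root_at E j) = l j" using Ek j by (simp add: root_at_def m)
  moreover have "(Tot D E, root_at E j) \<in> RF" "(Tot D F, root_at F j) \<in> RF"
    using Tot_rforest[OF D j] Ek by blast+
  moreover have "res (Tot D F, root_at F j) = res (Tot D E, root_at E j)"
    using residual_Tot[OF D j] Ek by simp
  ultimately show "(Tot D F, root_at F j) \<in> canonical VH RH (l j)"
    by (intro canonicalI[where D = "Tot D E" and k = m])
qed

lemma good_canonical:
  assumes H: "\<And>R hs. hs \<in> RH R \<Longrightarrow> R \<in> sig \<and> length hs = ar R \<and> set hs \<subseteq> VH"
    and none: "\<And>D k. D \<in> Ob \<Longrightarrow> V D \<noteq> {} \<Longrightarrow> \<not> hom_into D VH RH k"
  shows "good (canonical VH RH) VH RH"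
  unfolding good_def
proof (intro conjI ballI allI impI)
  fix h assume h: "h \<in> VH"
  show "colour (canonical VH RH h)"
    unfolding colour_def
  proof (intro conjI ballI impI)
    show "canonical VH RH h \<subseteq> RF" by (auto simp: canonical_def)
    show "q \<in> canonical VH RH h" if "p \<in> canonical VH RH h" "q \<in> RF" "res q = res p" for p q
      using that by (simp add: canonical_def)
    have "hom_into pt VH RH (\<lambda>_. h)" using h by (simp add: hom_into_def)
    then show "(pt, 0) \<in> canonical VH RH h"
      using pt_rforest[of sig ar] unfolding canonical_def by force
    fix q assume "q \<in> canonical VH RH h"
    then obtain p k where pk: "q \<in> RF" "p \<in> RF" "res q = res p" "hom_into (fst p) VH RH k"
      by (rule canonicalE)
    then have "fst p \<notin> Ob" using none rforestsD(3) by blast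
    \<comment> \<open>Testing the residual against the single point reveals whether the unrooted
      forest is in \<open>Ob\<close>, so saturation adds no member of \<open>Ob\<close>.\<close>
    moreover have "fst p \<in> Ob \<longleftrightarrow> (pt, 0) \<in> res p" if "p \<in> RF" for p
    proof -
      have "is_forest sig ar (glue (fst p) (snd p) pt 0)"
        using is_forest_glue rforestsD[OF that] rforestsD[OF pt_rforest] by fastforce
      then have "fst p \<in> Ob \<longleftrightarrow> glue (fst p) (snd p) pt 0 \<in> Ob"
        using Ob_isomorphic[OF rforestsD(2)[OF that] forest_wf] isomorphic_glue_pt[OF rforestsD(3)[OF that]]
        by blast
      then show ?thesis using pt_rforest[of sig ar] by (simp add: residual_def rforests_def)
    qed
    ultimately show "fst q \<notin> Ob" using pk by blast
  qed
  show "pair_ok (canonical VH RH h) (canonical VH RH h')" if "h' \<in> VH" for h'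
  proof -
    have "hom_into two_points VH RH (\<lambda>i. if i = 0 then h else h')"
      using h that by (auto simp: hom_into_def)
    then have "closed_under two_points (\<lambda>i. canonical VH RH (if i = 0 then h else h'))"
      by (intro closed_under_canonical is_forest_discrete) auto
    then show ?thesis
      unfolding pair_ok_def
      by (subst closed_under_cong[where c' = "\<lambda>i. canonical VH RH (if i = 0 then h else h')"]) auto
  qed
  show "nullary_ok R (canonical VH RH h)" if "[] \<in> RH R" for R
  proof -
    have "hom_into (edge R 1 0) VH RH (\<lambda>_. h)" using h that by (auto simp: hom_into_def)
    then show ?thesis
      unfolding nullary_ok_def using H[OF that] by (intro closed_under_canonical is_forest_edge) auto
  qed
next
  fix R hs assume hs: "hs \<in> RH R" "hs \<noteq> []"
  have "hom_into (edge R (length hs) (length hs)) VH RH ((!) hs)"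
    using H[OF hs(1)] hs(1) map_nth[of hs] by (auto simp: hom_into_def)
  then have "closed_under (edge R (length hs) (length hs)) (\<lambda>i. canonical VH RH (hs ! i))"
    using H[OF hs(1)] by (intro closed_under_canonical is_forest_edge) auto
  then show "tuple_ok R (map (canonical VH RH) hs)"
    unfolding tuple_ok_def
    by (subst closed_under_cong[where c' = "\<lambda>i. canonical VH RH (hs ! i)"]) auto
qed

text \<open>An element of \<open>Ob\<close> without vertices receives no colour and is invisible to
  colourings, whence the restriction on \<open>V D\<close>.\<close>

lemma duality:
  assumes "\<And>R hs. hs \<in> RH R \<Longrightarrow> R \<in> sig \<and> length hs = ar R \<and> set hs \<subseteq> VH"
  shows "(\<exists>D\<in>Ob. V D \<noteq> {} \<and> (\<exists>k. hom_into D VH RH k)) \<longleftrightarrow> \<not> (\<exists>c. good c VH RH)"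
  using good_canonical[of RH VH, OF assms] good_notin_Ob ObD by metis

end


section \<open>Homomorphisms without a section\<close>

text \<open>A vertex of the lifted target is a vertex \<open>x\<close> of \<open>C\<close>, together with a block through \<open>x\<close>
  if \<open>x \<in> K\<close>: the direction in which no partial section through the given point over \<open>x\<close> exists.
  \<open>N\<close> is a set of nullary symbols that are dropped.\<close>

type_synonym 'r choice = "nat \<times> ('r \<times> nat list) option"

definition HV :: "'r sstruct \<Rightarrow> nat set \<Rightarrow> 'r choice set" where
  "HV C K = {(x, z). (z = None \<and> x \<in> V C \<and> x \<notin> K) \<or>
     (\<exists>R xs. z = Some (R, xs) \<and> x \<in> K \<and> xs \<in> Rel C R \<and> x \<in> set xs)}"

text \<open>An entry that chooses a block declares its obstruction to lie across that block, hence
  at some other entry of any tuple over it. So the entries of a tuple must not all choose the block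
  below them. This is the relation of the dual of a tree, taken relative to the projection to
  \<open>C\<close>.\<close>

definition HR :: "'r sstruct \<Rightarrow> nat set \<Rightarrow> 'r set \<Rightarrow> 'r \<Rightarrow> 'r choice list set" where
  "HR C K N R = {hs. set hs \<subseteq> HV C K \<and> map fst hs \<in> Rel C R \<and> (hs = [] \<longrightarrow> R \<notin> N) \<and>
     (hs \<noteq> [] \<longrightarrow> fst ` set hs \<subseteq> K \<longrightarrow> (\<exists>h\<in>set hs. snd h \<noteq> Some (R, map fst hs)))}"

text \<open>Unions of connected components; an obstruction is pursued within such a set.\<close>

definition comp_set :: "'r sstruct \<Rightarrow> nat set \<Rightarrow> bool" where
  "comp_set C K \<longleftrightarrow> K \<subseteq> V C \<and> (\<forall>R. \<forall>xs\<in>Rel C R. set xs \<inter> K \<noteq> {} \<longrightarrow> set xs \<subseteq> K)"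

text \<open>Excludes the case in which the lifted target imposes no obstruction: with
  \<open>K\<close> empty and no nullary tuple of \<open>C\<close> dropped it is just a copy of
  \<open>C\<close>.\<close>

definition nontrivial :: "'r sstruct \<Rightarrow> nat set \<Rightarrow> 'r set \<Rightarrow> bool" where
  "nontrivial C K N \<longleftrightarrow> K \<noteq> {} \<or> (\<exists>R\<in>N. [] \<in> Rel C R)"

lemma HV_iff:
  "(x, z) \<in> HV C K \<longleftrightarrow> (z = None \<and> x \<in> V C \<and> x \<notin> K) \<or>
     (\<exists>R xs. z = Some (R, xs) \<and> x \<in> K \<and> xs \<in> Rel C R \<and> x \<in> set xs)"
  by (simp add: HV_def)

lemma HV_fst_in: "h \<in> HV C K \<Longrightarrow> fst h \<in> K \<Longrightarrow>
    \<exists>R xs. snd h = Some (R, xs) \<and> xs \<in> Rel C R \<and> fst h \<in> set xs"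
  by (cases h) (auto simp: HV_iff)

lemma HV_fst_notin: "h \<in> HV C K \<Longrightarrow> fst h \<notin> K \<Longrightarrow> snd h = None \<and> fst h \<in> V C"
  by (cases h) (auto simp: HV_iff)

lemma HR_I:
  assumes "set hs \<subseteq> HV C K" "map fst hs \<in> Rel C R" "hs = [] \<Longrightarrow> R \<notin> N"
    "hs \<noteq> [] \<Longrightarrow> fst ` set hs \<subseteq> K \<Longrightarrow> \<exists>h\<in>set hs. snd h \<noteq> Some (R, map fst hs)"
  shows "hs \<in> HR C K N R"
  using assms unfolding HR_def by blast

lemma HR_D:
  assumes "hs \<in> HR C K N R"
  shows "set hs \<subseteq> HV C K" "map fst hs \<in> Rel C R" "hs = [] \<Longrightarrow> R \<notin> N"
    "hs \<noteq> [] \<Longrightarrow> fst ` set hs \<subseteq> K \<Longrightarrow> \<exists>h\<in>set hs. snd h \<noteq> Some (R, map fst hs)"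
  using assms unfolding HR_def by blast+

text \<open>The private vertices of a leaf block lie on no other block, so they choose it. If its
  attachment vertex does so too, the block is found. Otherwise no vertex of the remaining blocks
  chooses it, and it can be removed.\<close>

lemma block_chosen_by_all:
  assumes "leafy \<B>" "finite F" "F \<subseteq> \<B>" "F \<noteq> {}" "\<And>e. e \<in> F \<Longrightarrow> snd e \<noteq> []"
    "\<And>e x. e \<in> F \<Longrightarrow> x \<in> set (snd e) \<Longrightarrow> \<epsilon> x \<in> F \<and> x \<in> set (snd (\<epsilon> x))"
  shows "\<exists>e\<in>F. \<forall>x\<in>set (snd e). \<epsilon> x = e"
  using assms(2-)
proof (induction "card F" arbitrary: F rule: less_induct)
  case less
  obtain e y where ey: "leaf_in F e y"
    by (rule leafyD[OF assms(1) less.prems(2,1,3)]) (use less.prems(4) in auto)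
  note e = leaf_inD[OF ey]
  have \<epsilon>: "\<epsilon> x = e" if "x \<in> set (snd e)" "x \<noteq> y" for x
    using e(3)[of x "\<epsilon> x"] less.prems(5)[OF e(1) that(1)] that by blast
  show ?case
  proof (cases "\<epsilon> y = e")
    case True
    then show ?thesis using \<epsilon> e(1) by metis
  next
    case False
    let ?F = "F - {e}"
    have "card ?F < card F" using e(1) less.prems(1) by (meson card_Diff1_less)
    moreover have "\<epsilon> y \<in> ?F" using less.prems(5)[OF e(1,2)] False by blast
    moreover have "\<epsilon> x \<in> ?F \<and> x \<in> set (snd (\<epsilon> x))" if "f \<in> ?F" "x \<in> set (snd f)" for f x
    proof -
      have "\<epsilon> x \<in> F" "x \<in> set (snd (\<epsilon> x))" using less.prems(5) that by blast+
      moreover have "\<epsilon> x \<noteq> e"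
        using e(3)[of x f] that False calculation by auto
      ultimately show ?thesis by blast
    qed
    ultimately have "\<exists>f\<in>?F. \<forall>x\<in>set (snd f). \<epsilon> x = f"
      using less.prems by (intro less.hyps) auto
    then show ?thesis by blast
  qed
qed

text \<open>Along a section every vertex of \<open>K\<close> acquires a chosen block, so some block
  of \<open>C\<close> is chosen by all its vertices; the section takes it to a tuple of
  \<open>D\<close> whose image in the lifted target is forbidden by \<open>HR\<close>. If
  \<open>K\<close> is empty, the section would produce a nullary tuple that was dropped.\<close>

lemma lift_no_section:
  assumes C: "is_forest sig ar C" and K: "comp_set C K" and nt: "nontrivial C K N"
    and h: "hom_into D (HV C K) (HR C K N) h" and s: "hom C D s" "\<And>x. x \<in> V C \<Longrightarrow> fst (h (s x)) = x"
  shows False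
proof (cases "K = {}")
  case True
  then obtain R where "R \<in> N" "[] \<in> Rel C R" using nt by (auto simp: nontrivial_def)
  then have "[] \<in> Rel D R" using s(1) unfolding hom_def by fastforce
  then have "map h [] \<in> HR C K N R" using h unfolding hom_into_def by blast
  then show False using \<open>R \<in> N\<close> HR_D(3) by fastforce
next
  case False
  define \<epsilon> where "\<epsilon> x = the (snd (h (s x)))" for x
  have KV: "K \<subseteq> V C" using K by (simp add: comp_set_def)
  have sV: "s x \<in> V D" if "x \<in> V C" for x using s(1) that by (auto simp: hom_def)
  have hV: "h d \<in> HV C K" if "d \<in> V D" for d using h that by (auto simp: hom_into_def)
  have \<epsilon>: "snd (h (s x)) = Some (\<epsilon> x) \<and> \<epsilon> x \<in> blocks C \<and> x \<in> set (snd (\<epsilon> x))" if "x \<in> K" for x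
    using HV_fst_in[OF hV[OF sV]] that KV s(2) by (fastforce simp: \<epsilon>_def blocks_def)
  have closed: "set (snd e) \<subseteq> K" if "e \<in> \<epsilon> ` K" for e
  proof -
    obtain x where "x \<in> K" "e = \<epsilon> x" using \<open>e \<in> \<epsilon> ` K\<close> by blast
    then have "e \<in> blocks C" "x \<in> set (snd e) \<inter> K" using \<epsilon> by auto
    then show ?thesis using K unfolding comp_set_def blocks_def by (cases e) auto
  qed
  have finK: "finite K" using KV forest_wf[OF C] wf_finite finite_subset by metis
  have "\<exists>e\<in>\<epsilon> ` K. \<forall>x\<in>set (snd e). \<epsilon> x = e"
  proof (rule block_chosen_by_all)
    show "leafy (blocks C)" using C by (simp add: is_forest_leafy)
    show "\<epsilon> ` K \<subseteq> blocks C" using \<epsilon> by blast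
    show "snd e \<noteq> []" if "e \<in> \<epsilon> ` K" for e using that \<epsilon> by fastforce
    show "\<epsilon> x \<in> \<epsilon> ` K \<and> x \<in> set (snd (\<epsilon> x))" if "e \<in> \<epsilon> ` K" "x \<in> set (snd e)" for e x
      using closed that \<epsilon> by blast
  qed (use finK False in auto)
  then obtain e where "e \<in> \<epsilon> ` K" "\<forall>x\<in>set (snd e). \<epsilon> x = e" by blast
  then obtain R xs where e: "(R, xs) \<in> \<epsilon> ` K" "\<And>x. x \<in> set xs \<Longrightarrow> \<epsilon> x = (R, xs)"
    by (cases e) simp
  then have xs: "xs \<in> Rel C R" "set xs \<subseteq> K" "xs \<noteq> []"
    using \<epsilon> closed[OF e(1)] by (fastforce simp: blocks_def)+
  have "map s xs \<in> Rel D R" using s(1) xs(1) by (auto simp: hom_def)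
  then have hs: "map h (map s xs) \<in> HR C K N R" using h unfolding hom_into_def by blast
  have fst: "map fst (map h (map s xs)) = xs"
    using s(2) xs(2) KV by (auto intro!: map_idI)
  then have "fst ` set (map h (map s xs)) \<subseteq> K" using xs(2) by (metis set_map)
  then obtain x where "x \<in> set xs" "snd (h (s x)) \<noteq> Some (R, xs)"
    using HR_D(4)[OF hs] xs(3) unfolding fst by auto
  then show False using \<epsilon> e(2) xs(2) by auto
qed

text \<open>Leaf blocks of \<open>C\<close> are pruned one after another. A point over the
  attachment vertex that lies on no tuple over the pruned block cannot be used by a section; it is
  removed from \<open>D\<close> and later chooses that block. A section of what remains extends
  across the block.\<close>

lemma no_section_lift:
  assumes "finite sig" "is_forest sig ar C" "hom D C g" "\<And>R zs. zs \<in> Rel D R \<Longrightarrow> set zs \<subseteq> V D"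
  shows "(\<exists>s. hom C D s \<and> (\<forall>x\<in>V C. g (s x) = x)) \<or>
    (\<exists>K N h. comp_set C K \<and> nontrivial C K N \<and> hom_into D (HV C K) (HR C K N) h \<and>
       (\<forall>d\<in>V D. fst (h d) = g d))"
  using assms(2-)
proof (induction "card {e \<in> blocks C. snd e \<noteq> []}" arbitrary: C D rule: less_induct)
  case less
  let ?F = "{e \<in> blocks C. snd e \<noteq> []}"
  have finF: "finite ?F" using finite_blocks[OF assms(1) forest_wf[OF less.prems(1)]] by simp
  note gC = less.prems(2)[unfolded hom_def]
  show ?case
  proof (cases "?F = {}")
    case True
    then have nil: "xs = []" if "xs \<in> Rel C R" for xs R using that by (auto simp: blocks_def)
    have nilD: "zs = []" if "zs \<in> Rel D R" for zs R
      using gC that nil by fastforce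
    \<comment> \<open>Without nonempty blocks, a section can only fail at a vertex that
      \<open>g\<close> misses or at a missing nullary tuple. In the first case \<open>K\<close> is
      that vertex alone: being isolated it has no point above it in the lifted target, and none is
      required.\<close>
    consider (empty) x where "x \<in> V C" "x \<notin> g ` V D" | (nullary) R where "[] \<in> Rel C R" "[] \<notin> Rel D R"
      | (sec) "V C \<subseteq> g ` V D" "\<And>R. [] \<in> Rel C R \<Longrightarrow> [] \<in> Rel D R" by blast
    then show ?thesis
    proof cases
      case empty
      have "comp_set C {x}" using empty nil by (fastforce simp: comp_set_def)
      moreover have "hom_into D (HV C {x}) (HR C {x} {}) (\<lambda>d. (g d, None))"
        using empty gC nilD by (fastforce simp: hom_into_def HV_def HR_def)
      ultimately show ?thesis
        by (intro disjI2 exI[of _ "{x}"] exI[of _ "{}"] exI[of _ "\<lambda>d. (g d, None)"])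
          (simp add: nontrivial_def)
    next
      case nullary
      have "comp_set C {}" by (simp add: comp_set_def)
      moreover have "hom_into D (HV C {}) (HR C {} {R}) (\<lambda>d. (g d, None))"
        using nullary gC nilD by (fastforce simp: hom_into_def HV_def HR_def)
      moreover have "nontrivial C {} {R}" using nullary by (simp add: nontrivial_def)
      ultimately show ?thesis
        by (intro disjI2 exI[of _ "{}"] exI[of _ "{R}"] exI[of _ "\<lambda>d. (g d, None)"]) simp
    next
      case sec
      define s where "s = inv_into (V D) g"
      have "g (s x) = x \<and> s x \<in> V D" if "x \<in> V C" for x
        using sec(1) that unfolding s_def by (meson f_inv_into_f inv_into_into subsetD)
      moreover have "map s xs \<in> Rel D R" if "xs \<in> Rel C R" for xs R
        using nil[OF that] sec(2) that by simp
      ultimately show ?thesis unfolding hom_def by blast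
    qed
  next
    case False
    have lf: "leafy (blocks C)" using less.prems(1) by (simp add: is_forest_leafy)
    obtain e y where ey: "leaf_in ?F e y"
      by (rule leafyD[OF lf _ finF False]) auto
    obtain R xs where e: "e = (R, xs)" by force
    have xs: "xs \<in> Rel C R" "y \<in> set xs" using leaf_inD(1,2)[OF ey] e by (auto simp: blocks_def)
    have only: "x = y" if "x \<in> set xs" "us \<in> Rel C R'" "x \<in> set us" "(R', us) \<noteq> (R, xs)" for x us R'
    proof -
      have "us \<noteq> []" using that(3) by auto
      then show ?thesis using leaf_inD(3)[OF ey, of x "(R', us)"] that by (simp add: e blocks_def)
    qed
    have wfC: "wf_struct sig ar C" using less.prems(1) forest_wf by blast
    have dist: "distinct xs" using less.prems(1) xs(1) by (simp add: is_forest_def)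
    have xsV: "set xs \<subseteq> V C" using wfD(3)[OF wfC xs(1)] .
    define C' where "C' = \<lparr>V = V C - (set xs - {y}), Rel = (\<lambda>R'. Rel C R' - (if R' = R then {xs} else {}))\<rparr>"
    have relC': "us \<in> Rel C' R' \<longleftrightarrow> us \<in> Rel C R' \<and> (R', us) \<noteq> (R, xs)" for us R'
      by (auto simp: C'_def split: if_splits)
    have VC': "x \<in> V C' \<longleftrightarrow> x \<in> V C \<and> (x \<in> set xs \<longrightarrow> x = y)" for x by (auto simp: C'_def)
    have usV: "set us \<subseteq> V C'" if "us \<in> Rel C' R'" for us R'
    proof
      fix x assume "x \<in> set us"
      then show "x \<in> V C'"
        using that wfD(3)[OF wfC, of us R'] only[of x us R'] by (auto simp: relC' VC')
    qed
    have wf': "wf_struct sig ar C'"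
      unfolding wf_struct_def
    proof (intro conjI allI impI ballI)
      show "length us = ar R'" if "us \<in> Rel C' R'" for us R' using wfD(2)[OF wfC] that relC' by blast
    qed (use wfC usV in \<open>auto simp: C'_def wf_struct_def\<close>)
    have forest': "is_forest sig ar C'"
      using is_forest_sub[OF less.prems(1) wf'] relC' by blast
    have "{e \<in> blocks C'. snd e \<noteq> []} = ?F - {e}" using relC' by (auto simp: blocks_def e)
    then have smaller: "card {e \<in> blocks C'. snd e \<noteq> []} < card ?F"
      using leaf_inD(1)[OF ey] finF by (metis (no_types, lifting) card_Diff1_less)
    \<comment> \<open>Points over the private vertices of the leaf block are dropped, and points
      over \<open>y\<close> are kept only if some tuple over the leaf block passes through
      them.\<close>
    define G where "G = {d \<in> V D. g d \<in> V C' \<and> (g d = y \<longrightarrow> (\<exists>zs\<in>Rel D R. map g zs = xs \<and> d \<in> set zs))}"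
    define D' where "D' = \<lparr>V = G, Rel = (\<lambda>R'. {zs \<in> Rel D R'. set zs \<subseteq> G \<and> (R', map g zs) \<noteq> (R, xs)})\<rparr>"
    have "hom D' C' g" using gC by (auto simp: hom_def D'_def G_def relC')
    moreover have "\<And>R zs. zs \<in> Rel D' R \<Longrightarrow> set zs \<subseteq> V D'" by (auto simp: D'_def)
    ultimately consider
      (sec) s where "hom C' D' s" "\<And>x. x \<in> V C' \<Longrightarrow> g (s x) = x"
      | (lift) K N h where "comp_set C' K" "nontrivial C' K N" "hom_into D' (HV C' K) (HR C' K N) h"
        "\<And>d. d \<in> G \<Longrightarrow> fst (h d) = g d"
      using less.hyps[OF smaller forest', of D'] by (fastforce simp: D'_def)
    then show ?thesis
    proof cases
      case sec
      have yC': "y \<in> V C'" using xs xsV VC' by blast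
      then have sy: "s y \<in> G" "g (s y) = y" using sec by (auto simp: hom_def D'_def)
      then obtain zs where zs: "zs \<in> Rel D R" "map g zs = xs" "s y \<in> set zs"
        by (auto simp: G_def)
      \<comment> \<open>Since \<open>xs\<close> has distinct entries, \<open>g\<close> is injective
        on the tuple \<open>zs\<close> above it; its inverse there extends the section to the
        private vertices.\<close>
      define t where "t = inv_into (set zs) g"
      have "inj_on g (set zs)" using dist zs(2) distinct_map by blast
      then have t: "t (g w) = w" if "w \<in> set zs" for w using that by (simp add: t_def)
      define s' where "s' x = (if x \<in> set xs then t x else s x)" for x
      have "map t xs = zs" using t zs(2) by (metis (no_types, lifting) map_idI map_map comp_apply)
      then have s'xs: "map s' xs = zs" by (metis (no_types, lifting) map_cong s'_def)
      have s'C': "s' x = s x" if "x \<in> V C'" for x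
        using that t[OF zs(3)] sy by (auto simp: s'_def VC')
      have "hom C D s'"
        unfolding hom_def
      proof (intro conjI allI ballI)
        show "s' ` V C \<subseteq> V D"
        proof
          fix w assume "w \<in> s' ` V C"
          then obtain x where x: "x \<in> V C" "w = s' x" by blast
          show "w \<in> V D"
          proof (cases "x \<in> set xs")
            case True
            then have "w \<in> set (map s' xs)" using x by simp
            then show ?thesis using s'xs less.prems(3)[OF zs(1)] by auto
          next
            case False
            then have "x \<in> V C'" using x VC' by blast
            then show ?thesis using s'C' sec(1) x by (auto simp: hom_def D'_def G_def)
          qed
        qed
        fix R' us assume us: "us \<in> Rel C R'"
        show "map s' us \<in> Rel D R'"
        proof (cases "(R', us) = (R, xs)")
          case True
          then show ?thesis using s'xs zs(1) by simp
        next
          case False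
          then have us': "us \<in> Rel C' R'" using us relC' by blast
          then have "map s us \<in> Rel D R'" using sec(1) by (auto simp: hom_def D'_def)
          moreover have "map s' us = map s us" using s'C' usV[OF us'] by auto
          ultimately show ?thesis by metis
        qed
      qed
      moreover have "g (s' x) = x" if "x \<in> V C" for x
      proof (cases "x \<in> set xs")
        case True
        then obtain w where "w \<in> set zs" "x = g w" using zs(2) by auto
        then show ?thesis using t True by (simp add: s'_def)
      next
        case False
        then show ?thesis using sec(2) that VC' by (simp add: s'_def)
      qed
      ultimately show ?thesis by blast
    next
      case lift
      have KC': "K \<subseteq> V C'" using lift(1) by (simp add: comp_set_def)
      \<comment> \<open>The private vertices join \<open>K\<close> exactly when their neighbour
        \<open>y\<close> is in it. Points newly added over the block then choose it: for a private
        vertex it is the only block available, and at \<open>y\<close> it is the direction in which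
        extension fails.\<close>
      define K' where "K' = (if y \<in> K then K \<union> set xs else K)"
      define h' where "h' d = (if d \<in> G then h d else (g d, if y \<in> K then Some (R, xs) else None))" for d
      have KK': "x \<in> K' \<longleftrightarrow> x \<in> K" if "x \<in> V C'" for x using that by (auto simp: K'_def VC')
      have "comp_set C K'"
        unfolding comp_set_def
      proof (intro conjI allI ballI impI)
        show "K' \<subseteq> V C" using KC' xsV by (auto simp: K'_def VC')
        fix R' us assume us: "us \<in> Rel C R'" "set us \<inter> K' \<noteq> {}"
        show "set us \<subseteq> K'"
        proof (cases "(R', us) = (R, xs)")
          case True
          then show ?thesis using us(2) KC' VC' by (auto simp: K'_def split: if_splits)
        next
          case False
          then have us': "us \<in> Rel C' R'" using us relC' by blast
          then have "set us \<inter> K \<noteq> {}" using us(2) usV KK' by blast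
          then have "set us \<subseteq> K" using lift(1) us' by (simp add: comp_set_def)
          then show ?thesis by (auto simp: K'_def)
        qed
      qed
      moreover have "nontrivial C K' N"
        using lift(2) relC' by (auto simp: nontrivial_def K'_def)
      moreover have fst: "fst (h' d) = g d" for d using lift(4) by (simp add: h'_def)
      moreover have "hom_into D (HV C K') (HR C K' N) h'"
      proof -
        have hG: "h d \<in> HV C' K" if "d \<in> G" for d
          using lift(3) that by (auto simp: hom_into_def D'_def)
        have notG: "g d \<in> set xs \<and> (g d \<in> V C' \<longrightarrow> g d = y)" if "d \<in> V D" "d \<notin> G" for d
          using that gC xs(2) by (auto simp: G_def VC')
        have vert: "h' d \<in> HV C K'" if d: "d \<in> V D" for d
        proof (cases "d \<in> G")
          case True
          obtain x z where xz: "h d = (x, z)" by force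
          then show ?thesis
            using hG[OF True] KK'[of x] KC' True relC' by (auto simp: HV_iff h'_def VC')
        next
          case False
          then show ?thesis
            using notG[OF d False] gC d xs KC' by (auto simp: h'_def HV_iff K'_def VC')
        qed
        have tup: "map h' zs \<in> HR C K' N R'" if zs: "zs \<in> Rel D R'" for zs R'
        proof (rule HR_I)
          have zsV: "set zs \<subseteq> V D" using less.prems(3)[OF zs] .
          show "set (map h' zs) \<subseteq> HV C K'" using vert zsV by auto
          have mapfst: "map fst (map h' zs) = map g zs" using fst by simp
          show "map fst (map h' zs) \<in> Rel C R'" unfolding mapfst using gC zs by blast
          have inD': "map h zs \<in> HR C' K N R'" if "zs \<in> Rel D' R'"
            using lift(3) that by (auto simp: hom_into_def)
          show "R' \<notin> N" if "map h' zs = []"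
          proof -
            have "zs \<in> Rel D' R'" using that zs xs(2) by (auto simp: D'_def)
            then show ?thesis using HR_D(3)[OF inD'] that by simp
          qed
          assume ne: "map h' zs \<noteq> []" and subK: "fst ` set (map h' zs) \<subseteq> K'"
          show "\<exists>k\<in>set (map h' zs). snd k \<noteq> Some (R', map fst (map h' zs))"
          \<comment> \<open>A tuple over the leaf block has its entry over \<open>y\<close> in
            \<open>G\<close>, and that entry has chosen a block of \<open>C'\<close>. Over any other
            block, an entry outside \<open>G\<close> lies over \<open>y\<close> and has chosen the
            leaf block; if there is no such entry, the old lift \<open>h\<close> already provides a
            dissenting one.\<close>
          proof (cases "(R', map g zs) = (R, xs)")
            case True
            then have zsR: "zs \<in> Rel D R" "map g zs = xs" using zs by auto
            then obtain d where d: "d \<in> set zs" "g d = y" using xs(2) by auto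
            then have dG: "d \<in> G" using zsR zsV xs xsV by (auto simp: G_def VC')
            have "y \<in> K'" using subK d fst by force
            then have yK: "y \<in> K" by (auto simp: K'_def split: if_splits)
            obtain R1 us where "snd (h d) = Some (R1, us)" "us \<in> Rel C' R1"
              using HV_fst_in[OF hG[OF dG]] lift(4)[OF dG] d(2) yK by auto
            then have "snd (h' d) \<noteq> Some (R, xs)" using dG relC' by (auto simp: h'_def)
            then show ?thesis using d(1) True mapfst by auto
          next
            case False
            then have us: "map g zs \<in> Rel C' R'" using gC zs relC' by blast
            have inC': "g d \<in> V C'" if "d \<in> set zs" for d using usV[OF us] that by auto
            have inK: "g d \<in> K" if "d \<in> set zs" for d
            proof -
              have "h' d \<in> set (map h' zs)" using that by simp
              then have "fst (h' d) \<in> K'" using subK by blast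
              then show ?thesis using KK'[OF inC'[OF that]] fst by simp
            qed
            show ?thesis
            proof (cases "set zs \<subseteq> G")
              case True
              then have hs: "map h zs \<in> HR C' K N R'" using inD' zs False by (simp add: D'_def)
              have eq: "map h' zs = map h zs" using True by (auto simp: h'_def)
              have "fst ` set (map h zs) \<subseteq> K" using inK fst unfolding eq[symmetric] by auto
              then show ?thesis using HR_D(4)[OF hs] ne unfolding eq by blast
            next
              case notin: False
              then obtain d where d: "d \<in> set zs" "d \<notin> G" by blast
              then have "g d = y" using notG[of d] zsV inC'[of d] by auto
              then have "y \<in> K" using inK[OF d(1)] by simp
              then have "snd (h' d) = Some (R, xs)" using d by (simp add: h'_def)
              then show ?thesis using False d(1) mapfst by (intro bexI[of _ "h' d"]) auto
            qed
          qed
        qed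
        show ?thesis using vert tup by (auto simp: hom_into_def)
      qed
      ultimately show ?thesis by blast
    qed
  qed
qed


section \<open>Cores of minimal elements\<close>

lemma hom_comp: "hom A B f \<Longrightarrow> hom B C g \<Longrightarrow> hom A C (g \<circ> f)"
  unfolding hom_def by (simp add: image_subset_iff flip: map_map)

lemma homto_trans: "homto A B \<Longrightarrow> homto B C \<Longrightarrow> homto A C"
  using hom_comp unfolding homto_def by blast

lemma hom_funpow: "hom C C e \<Longrightarrow> hom C C (e ^^ n)"
proof (induction n)
  case 0
  then show ?case by (simp add: hom_def)
next
  case (Suc n)
  then show ?case using hom_comp[of C C "e ^^ n" C e] by (simp add: comp_def)
qed

lemma funpow_identity:
  assumes "finite S" "e ` S \<subseteq> S" "inj_on e S"
  shows "\<exists>n>0. \<forall>x\<in>S. (e ^^ n) x = x"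
proof -
  have pow: "(e ^^ i) x \<in> S" if "x \<in> S" for i x
    using that assms(2) by (induction i) auto
  have inj: "inj_on (e ^^ i) S" for i
  proof (induction i)
    case (Suc i)
    have "inj_on e ((e ^^ i) ` S)" using assms(3) pow by (auto intro: inj_on_subset)
    then show ?case using Suc comp_inj_on[of "e ^^ i" S e] by (simp add: comp_def)
  qed simp
  \<comment> \<open>Powers are compared through their graphs over \<open>S\<close>, which range over
    a finite set.\<close>
  define G where "G i = (\<lambda>x. (x, (e ^^ i) x)) ` S" for i :: nat
  have "range G \<subseteq> Pow (S \<times> S)" using pow by (auto simp: G_def)
  then have "finite (range G)" by (rule finite_subset) (use assms(1) in auto)
  then have "\<not> inj G" using infinite_UNIV_nat finite_imageD by blast
  then obtain i j where ij: "i < j" "G i = G j" unfolding inj_def by (metis linorder_neqE_nat)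
  have "(e ^^ (j - i)) x = x" if "x \<in> S" for x
  proof -
    have "(e ^^ i) x = (e ^^ j) x" using ij(2) that by (auto simp: G_def)
    also have "\<dots> = (e ^^ i) ((e ^^ (j - i)) x)"
      using ij(1) by (metis comp_apply funpow_add le_add_diff_inverse less_imp_le_nat)
    finally show ?thesis using inj[of i] pow[OF that] that by (metis inj_onD)
  qed
  then show ?thesis using ij(1) by (intro exI[of _ "j - i"]) simp
qed

definition has_section :: "'r sstruct \<Rightarrow> 'r sstruct \<Rightarrow> (nat \<Rightarrow> nat) \<Rightarrow> bool" where
  "has_section D C g \<longleftrightarrow> (\<exists>s. hom C D s \<and> (\<forall>x\<in>V C. g (s x) = x))"

text \<open>A map \<open>h\<close> from \<open>C\<close> to \<open>D\<close> passes through
  \<open>A\<close>. The image of the endomorphism \<open>e = g \<circ> h\<close> is again equivalent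
  to \<open>A\<close>, so the minimal size of \<open>C\<close> makes \<open>e\<close> a permutation
  of \<open>V C\<close>. Some positive power \<open>e ^^ n\<close> is the identity there, and
  \<open>h \<circ> e ^^ (n - 1)\<close> is the section.\<close>

lemma core_section:
  assumes core: "is_core sig ar A C" and "homto A D" and g: "hom D C g"
  shows "has_section D C g"
proof -
  have wfC: "wf_struct sig ar C" and AC: "homto A C" and CA: "homto C A"
    using core by (auto simp: is_core_def)
  then obtain h where h: "hom C D h" using assms(2) homto_trans homto_def by metis
  define e where "e = g \<circ> h"
  have e: "hom C C e" unfolding e_def using h g hom_comp by blast
  have eV: "e ` V C \<subseteq> V C" and finC: "finite (V C)" using e wf_finite[OF wfC] by (auto simp: hom_def)
  have "wf_struct sig ar (img e C)"
    unfolding wf_struct_def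
  proof (intro conjI allI impI ballI)
    fix R xs assume "xs \<in> Rel (img e C) R"
    then obtain ys where ys: "ys \<in> Rel C R" "xs = map e ys" by (auto simp: img_def)
    then show "length xs = ar R" "set xs \<subseteq> V (img e C)"
      using wfD(2,3)[OF wfC ys(1)] by (auto simp: img_def)
  qed (use wfC in \<open>auto simp: img_def wf_struct_def\<close>)
  moreover have "hom C (img e C) e" by (simp add: hom_def img_def)
  moreover have "hom (img e C) C id" using e by (auto simp: hom_def img_def)
  ultimately have "card (V C) \<le> card (V (img e C))"
    using core AC CA homto_trans unfolding is_core_def homto_def by metis
  then have "card (e ` V C) = card (V C)"
    using card_image_le[OF finC, of e] by (simp add: img_def)
  then have "inj_on e (V C)" using finC eq_card_imp_inj_on by blast
  then obtain n where n: "n > 0" "\<forall>x\<in>V C. (e ^^ n) x = x"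
    using funpow_identity[OF finC eV] by blast
  have "hom C D (h \<circ> (e ^^ (n - 1)))" using hom_comp[OF hom_funpow[OF e] h] .
  moreover have "g ((h \<circ> (e ^^ (n - 1))) x) = x" if "x \<in> V C" for x
  proof -
    have "g ((h \<circ> (e ^^ (n - 1))) x) = (e ^^ Suc (n - 1)) x" by (simp add: e_def)
    then show ?thesis using n that by simp
  qed
  ultimately show ?thesis unfolding has_section_def by blast
qed

text \<open>If \<open>E\<close> in \<open>Ob\<close> maps to \<open>D0\<close>, it maps on to
  \<open>C\<close>, and a section leads back from \<open>C\<close>, hence from \<open>D0\<close>, to
  \<open>E\<close>. If \<open>D\<close> is equivalent to \<open>D0\<close>, a section of the
  composite from \<open>D0\<close> through \<open>D\<close> to \<open>C\<close> embeds
  \<open>V C\<close> into \<open>V D\<close>.\<close>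

lemma sections_imp_core:
  assumes wfC: "wf_struct sig ar C" and D0: "D0 \<in> Ob" "homto D0 C"
    and sec: "\<And>D g. D \<in> Ob \<Longrightarrow> hom D C g \<Longrightarrow> has_section D C g"
  shows "minimal_in Ob D0 \<and> is_core sig ar D0 C"
proof -
  have from_C: "homto C D" if "D \<in> Ob" "homto D C" for D
    using sec that unfolding homto_def has_section_def by blast
  have "homto D0 E" if "E \<in> Ob" "homto E D0" for E
    using from_C that D0 homto_trans by blast
  moreover have "card (V C) \<le> card (V D)"
    if D: "wf_struct sig ar D" "homto D0 D" "homto D D0" for D
  proof -
    obtain p q where p: "hom D0 D p" and q: "hom D C q"
      using D(2,3) D0(2) homto_trans unfolding homto_def by metis
    then have "has_section D0 C (q \<circ> p)" using sec[OF D0(1)] hom_comp by blast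
    then obtain s where s: "hom C D0 s" "\<And>x. x \<in> V C \<Longrightarrow> q (p (s x)) = x"
      unfolding has_section_def by auto
    have "inj_on (p \<circ> s) (V C)"
    proof (rule inj_onI)
      fix x x' assume "x \<in> V C" "x' \<in> V C" "(p \<circ> s) x = (p \<circ> s) x'"
      then show "x = x'" by (metis comp_apply s(2))
    qed
    moreover have "(p \<circ> s) ` V C \<subseteq> V D" using hom_comp[OF s(1) p] by (simp add: hom_def)
    ultimately show ?thesis using wf_finite[OF D(1)] by (rule card_inj_on_le)
  qed
  ultimately show ?thesis using D0 from_C wfC by (simp add: minimal_in_def is_core_def)
qed

definition cores :: "'r set \<Rightarrow> ('r \<Rightarrow> nat) \<Rightarrow> 'r sstruct set \<Rightarrow> 'r sstruct set" where
  "cores sig ar Ob = {C. \<exists>A. minimal_in Ob A \<and> is_core sig ar A C}"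

lemma cores_iff_sections:
  assumes "wf_struct sig ar C"
  shows "C \<in> cores sig ar Ob \<longleftrightarrow>
    (\<exists>D\<in>Ob. homto D C) \<and> (\<forall>D\<in>Ob. \<forall>g. hom D C g \<longrightarrow> has_section D C g)"
proof
  assume "C \<in> cores sig ar Ob"
  then obtain A where A: "minimal_in Ob A" "is_core sig ar A C" by (auto simp: cores_def)
  have "homto A D" if "D \<in> Ob" "hom D C g" for D g
    using A that homto_trans[of D C A] unfolding minimal_in_def is_core_def homto_def by metis
  then show "(\<exists>D\<in>Ob. homto D C) \<and> (\<forall>D\<in>Ob. \<forall>g. hom D C g \<longrightarrow> has_section D C g)"
    using A core_section unfolding minimal_in_def is_core_def by metis
next
  assume "(\<exists>D\<in>Ob. homto D C) \<and> (\<forall>D\<in>Ob. \<forall>g. hom D C g \<longrightarrow> has_section D C g)"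
  then show "C \<in> cores sig ar Ob"
    using sections_imp_core[OF assms] unfolding cores_def by blast
qed

text \<open>With \<open>K\<close> and \<open>N\<close> empty the lifted target is a copy of
  \<open>C\<close>, so the bare existence of a map from \<open>Ob\<close> to \<open>C\<close> is
  decided by colourings as well.\<close>

lemma hom_into_trivial_lift:
  assumes "hom D C g" "\<And>R zs. zs \<in> Rel D R \<Longrightarrow> set zs \<subseteq> V D"
  shows "hom_into D (HV C {}) (HR C {} {}) (\<lambda>d. (g d, None))"
proof -
  have vert: "(g d, None) \<in> HV C {}" if "d \<in> V D" for d
    using assms(1) that by (auto simp: hom_def HV_iff)
  have "map (\<lambda>d. (g d, None)) zs \<in> HR C {} {} R" if "zs \<in> Rel D R" for zs R
    using assms that vert by (intro HR_I) (auto simp: hom_def comp_def)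
  then show ?thesis using vert by (auto simp: hom_into_def)
qed

lemma hom_of_lift:
  assumes "hom_into D (HV C K) (HR C K N) h" "comp_set C K" "\<And>R xs. xs \<in> Rel C R \<Longrightarrow> set xs \<subseteq> V C"
  shows "hom D C (\<lambda>d. fst (h d))"
  unfolding hom_def
proof (intro conjI allI ballI)
  have "fst p \<in> V C" if "p \<in> HV C K" for p
    using that HV_fst_in HV_fst_notin assms(2,3) unfolding comp_set_def by blast
  then show "(\<lambda>d. fst (h d)) ` V D \<subseteq> V C"
    using assms(1) unfolding hom_into_def by blast
  fix R zs assume "zs \<in> Rel D R"
  then have "map h zs \<in> HR C K N R" using assms(1) by (auto simp: hom_into_def)
  then have "map fst (map h zs) \<in> Rel C R" by (rule HR_D)
  then show "map (\<lambda>d. fst (h d)) zs \<in> Rel C R" by (simp add: comp_def)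
qed

section \<open>Criterion by colourings for being the core of a minimal element\<close>

context forest_class
begin

text \<open>To be read negatively: by \<open>liftable_duality\<close>, for a forest \<open>C\<close>
  it certifies that no element of \<open>Ob\<close> with a vertex maps to the lifted target.\<close>

definition liftable :: "'r sstruct \<Rightarrow> nat set \<Rightarrow> 'r set \<Rightarrow> bool" where
  "liftable C K N \<longleftrightarrow> (\<exists>c. good c (HV C K) (HR C K N))"

lemma liftable_duality:
  assumes C: "is_forest sig ar C"
  shows "(\<exists>D\<in>Ob. V D \<noteq> {} \<and> (\<exists>k. hom_into D (HV C K) (HR C K N) k)) \<longleftrightarrow> \<not> liftable C K N"
  unfolding liftable_def
proof (rule duality)
  fix R hs assume hs: "hs \<in> HR C K N R"
  show "R \<in> sig \<and> length hs = ar R \<and> set hs \<subseteq> HV C K"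
    using wfD(1,2)[OF forest_wf[OF C] HR_D(2)[OF hs]] HR_D(1)[OF hs] by simp
qed

text \<open>A vertexless element mapping to \<open>C\<close> would have no section, as
  \<open>C\<close> has vertices; hence the first clause. The second clause then provides an element
  of \<open>Ob\<close> that maps to \<open>C\<close>, and the third excludes a map without a
  section.\<close>

lemma cores_iff_liftable:
  assumes C: "is_forest sig ar C" "V C \<noteq> {}"
  shows "C \<in> cores sig ar Ob \<longleftrightarrow> (\<forall>D\<in>Ob. V D = {} \<longrightarrow> \<not> homto D C) \<and> \<not> liftable C {} {} \<and>
    (\<forall>K N. comp_set C K \<longrightarrow> nontrivial C K N \<longrightarrow> liftable C K N)"
    (is "_ \<longleftrightarrow> ?empty \<and> ?some \<and> ?all")
proof -
  have wfC: "wf_struct sig ar C" using C forest_wf by blast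
  have tupC: "\<And>R xs. xs \<in> Rel C R \<Longrightarrow> set xs \<subseteq> V C" using wfD(3)[OF wfC] .
  show ?thesis
    unfolding cores_iff_sections[OF wfC]
  proof (intro iffI conjI)
    assume *: "(\<exists>D\<in>Ob. homto D C) \<and> (\<forall>D\<in>Ob. \<forall>g. hom D C g \<longrightarrow> has_section D C g)"
    show empty: ?empty
      using * C(2) unfolding homto_def has_section_def hom_def by fastforce
    obtain D g where D: "D \<in> Ob" "hom D C g" using * homto_def by blast
    then have "V D \<noteq> {}" using empty homto_def by blast
    moreover have "\<And>R zs. zs \<in> Rel D R \<Longrightarrow> set zs \<subseteq> V D"
      using wfD(3)[OF forest_wf[OF ObD[OF D(1)]]] .
    ultimately show ?some using liftable_duality[OF C(1)] D(1) hom_into_trivial_lift[OF D(2)] by blast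
    show ?all
    proof (intro allI impI, rule ccontr)
      fix K N assume K: "comp_set C K" "nontrivial C K N" "\<not> liftable C K N"
      then obtain D k where D: "D \<in> Ob" "hom_into D (HV C K) (HR C K N) k"
        using liftable_duality[OF C(1)] by blast
      have "hom D C (\<lambda>d. fst (k d))" by (rule hom_of_lift[OF D(2) K(1)]) (rule tupC)
      then have "has_section D C (\<lambda>d. fst (k d))" using D(1) * by blast
      then obtain s where "hom C D s" "\<And>x. x \<in> V C \<Longrightarrow> fst (k (s x)) = x"
        unfolding has_section_def by blast
      then show False using lift_no_section[OF C(1) K(1,2) D(2)] by blast
    qed
  next
    assume *: "?empty \<and> ?some \<and> ?all"
    then obtain D k where D: "D \<in> Ob" "hom_into D (HV C {}) (HR C {} {}) k"
      using liftable_duality[OF C(1)] by blast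
    have "hom D C (\<lambda>d. fst (k d))"
      by (rule hom_of_lift[OF D(2)]) (auto simp: comp_set_def dest: tupC)
    then show "\<exists>D\<in>Ob. homto D C" using D(1) homto_def by blast
    show "\<forall>D\<in>Ob. \<forall>g. hom D C g \<longrightarrow> has_section D C g"
    proof (intro ballI allI impI, rule ccontr)
      fix D g assume D: "D \<in> Ob" "hom D C g" "\<not> has_section D C g"
      have "\<And>R zs. zs \<in> Rel D R \<Longrightarrow> set zs \<subseteq> V D"
        using wfD(3)[OF forest_wf[OF ObD[OF D(1)]]] .
      then obtain K N h where "comp_set C K" "nontrivial C K N" "hom_into D (HV C K) (HR C K N) h"
        using no_section_lift[OF finite_sig C(1) D(2)] D(3) unfolding has_section_def by blast
      moreover have "V D \<noteq> {}" using * D homto_def by blast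
      ultimately show False using liftable_duality[OF C(1)] D(1) * by blast
    qed
  qed
qed

end

section \<open>Exchange of colours at the root of a glueing\<close>

definition sunion :: "'r sstruct \<Rightarrow> 'r sstruct \<Rightarrow> 'r sstruct" where
  "sunion A B = \<lparr>V = V A \<union> V B, Rel = (\<lambda>R. Rel A R \<union> Rel B R)\<rparr>"

lemma sunion_simps [simp]: "V (sunion A B) = V A \<union> V B" "Rel (sunion A B) R = Rel A R \<union> Rel B R"
  by (simp_all add: sunion_def)

text \<open>Tuples supported on the root, nullary ones included, are excluded, so that a tuple of a
  union along the vertex \<open>0\<close> belongs to one side only.\<close>

definition unpinned :: "'r sstruct \<Rightarrow> bool" where
  "unpinned A \<longleftrightarrow> 0 \<in> V A \<and> (\<forall>R. \<forall>xs\<in>Rel A R. set xs \<subseteq> V A \<and> \<not> set xs \<subseteq> {0})"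

text \<open>The profile is what a colouring of a lift of \<open>A \<union> B\<close> reveals about \<open>A\<close>, glued to \<open>B\<close> at the
  vertex \<open>0\<close>: the colours \<open>X\<close> that \<open>A\<close> offers to \<open>B\<close> and the colours \<open>Y\<close> that \<open>B\<close> offers to \<open>A\<close> at
  the root. Seen from \<open>A\<close>, all choices made at the root inside \<open>B\<close> are the single multicoloured
  vertex \<open>(0, None)\<close>.\<close>

definition multicolouring :: "'r sstruct \<Rightarrow> nat set \<Rightarrow> ('r sstruct \<times> nat) set set \<Rightarrow>
    ('r choice \<Rightarrow> ('r sstruct \<times> nat) set set) \<Rightarrow> bool" where
  "multicolouring A K W m \<longleftrightarrow> (\<forall>h\<in>HV A K. h \<noteq> (0, None) \<longrightarrow> m h \<noteq> {}) \<and>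
     (\<forall>h\<in>insert (0, None) (HV A K). m h \<subseteq> W) \<and>
     (\<forall>R hs Ss. map fst hs \<in> Rel A R \<longrightarrow> set hs \<subseteq> insert (0, None) (HV A K) \<longrightarrow>
        (fst ` set hs \<subseteq> K \<longrightarrow> (\<exists>h\<in>set hs. snd h \<noteq> Some (R, map fst hs))) \<longrightarrow>
        list_all2 (\<lambda>h S. S \<in> m h) hs Ss \<longrightarrow> tuple_ok R Ss)"

definition profile :: "'r sstruct \<Rightarrow> nat set \<Rightarrow> (('r sstruct \<times> nat) set set \<times> ('r sstruct \<times> nat) set set \<times>
    ('r sstruct \<times> nat) set set) set" where
  "profile A K = {(W, \<Union>h\<in>{h\<in>HV A K. fst h = 0 \<and> snd h \<noteq> None}. m h, m (0, None)) |W m.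
     multicolouring A K W m}"

lemma multicolouringD:
  assumes "multicolouring A K W m"
  shows "\<And>h. h \<in> HV A K \<Longrightarrow> h \<noteq> (0, None) \<Longrightarrow> m h \<noteq> {}"
    "\<And>h. h \<in> insert (0, None) (HV A K) \<Longrightarrow> m h \<subseteq> W"
    "\<And>R hs Ss. map fst hs \<in> Rel A R \<Longrightarrow> set hs \<subseteq> insert (0, None) (HV A K) \<Longrightarrow>
        (fst ` set hs \<subseteq> K \<Longrightarrow> \<exists>h\<in>set hs. snd h \<noteq> Some (R, map fst hs)) \<Longrightarrow>
        list_all2 (\<lambda>h S. S \<in> m h) hs Ss \<Longrightarrow> tuple_ok R Ss"
  using assms unfolding multicolouring_def by blast+

lemma list_all2_choose:
  assumes "list_all2 (\<lambda>h S. \<exists>h'. Q h h' \<and> c h' = S) hs Ss"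
  shows "\<exists>hs'. list_all2 Q hs hs' \<and> map c hs' = Ss"
  using assms
proof (induction rule: list_all2_induct)
  case (Cons x xs y ys)
  then obtain hs' h' where "list_all2 Q xs hs'" "map c hs' = ys" "Q x h'" "c h' = y" by blast
  then show ?case by (intro exI[of _ "h' # hs'"]) simp
qed simp

context forest_class
begin

text \<open>The colouring \<open>c\<close> yields a profile of \<open>A\<close>; the same profile is
  realised over \<open>A'\<close>, and \<open>c\<close> is kept on the \<open>B\<close> side. In a
  tuple of \<open>A'\<close>, a root choice made in \<open>B\<close> is represented by the
  multicoloured vertex \<open>(0, None)\<close>. In a tuple of \<open>B\<close>, a root choice made
  in \<open>A'\<close> is traded for one in \<open>A\<close> with the same colour.\<close>

lemma liftable_transfer:
  assumes A: "unpinned A" and A': "unpinned A'" and B: "0 \<in> V B" "\<And>R xs. xs \<in> Rel B R \<Longrightarrow> set xs \<subseteq> V B"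
    and disj: "V A \<inter> V B = {0}" "V A' \<inter> V B = {0}"
    and K: "K \<inter> V B = K' \<inter> V B"
    and prof: "profile A (K \<inter> V A) \<inter> {(W, X, Y). W \<subseteq> Collect colour} =
      profile A' (K' \<inter> V A') \<inter> {(W, X, Y). W \<subseteq> Collect colour}"
    and lift: "liftable (sunion A B) K N"
  shows "liftable (sunion A' B) K' N"
proof -
  let ?C = "sunion A B" and ?C' = "sunion A' B"
  obtain c where c: "good c (HV ?C K) (HR ?C K N)" using lift liftable_def by blast
  have AV: "set xs \<subseteq> V A" "\<not> set xs \<subseteq> {0}" if "xs \<in> Rel A R" for xs R
    using A that by (auto simp: unpinned_def)
  have AV': "set xs \<subseteq> V A'" "\<not> set xs \<subseteq> {0}" if "xs \<in> Rel A' R" for xs R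
    using A' that by (auto simp: unpinned_def)
  have sep: "xs \<notin> Rel B R" if "xs \<in> Rel A R" for xs R
    using AV[OF that] B(2) disj(1) by blast
  have sep': "xs \<notin> Rel B R" if "xs \<in> Rel A' R" for xs R
    using AV'[OF that] B(2) disj(2) by blast
  have zero: "0 \<in> V A" "0 \<in> V A'" using A A' by (auto simp: unpinned_def)
  have K0: "0 \<in> K \<longleftrightarrow> 0 \<in> K'" using K B(1) by blast
  \<comment> \<open>All colours in use on either side: the pair and nullary conditions hold
    throughout \<open>W\<close> and pass to any colouring with values in it.\<close>
  define W where "W = c ` HV ?C K"
  define inA where "inA h \<longleftrightarrow> (\<exists>R xs. snd h = Some (R, xs) \<and> xs \<in> Rel A R)" for h :: "'r choice"
  \<comment> \<open>The multicoloured vertex collects the colours of all root choices not made in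
    \<open>A\<close>. If the root is outside \<open>K\<close>, this is just the colour of the
    root.\<close>
  define m where "m h = (if h = (0, None) then c ` {h\<in>HV ?C K. fst h = 0 \<and> \<not> inA h} else {c h})" for h
  define X where "X = (\<Union>h\<in>{h\<in>HV A (K \<inter> V A). fst h = 0 \<and> snd h \<noteq> None}. m h)"
  define Y where "Y = m (0, None)"
  have HA: "h \<in> HV ?C K" if "h \<in> HV A (K \<inter> V A)" for h
    using that by (cases h) (auto simp: HV_iff)
  have "multicolouring A (K \<inter> V A) W m"
    unfolding multicolouring_def
  proof (intro conjI ballI allI impI)
    show "m h \<noteq> {}" if "h \<noteq> (0, None)" for h using that by (simp add: m_def)
    show "m h \<subseteq> W" if "h \<in> insert (0, None) (HV A (K \<inter> V A))" for h
    proof (cases "h = (0, None)")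
      case False
      then show ?thesis using that HA[of h] by (simp add: m_def W_def)
    qed (auto simp: m_def W_def)
    fix R hs Ss
    assume hs: "map fst hs \<in> Rel A R" "set hs \<subseteq> insert (0, None) (HV A (K \<inter> V A))"
      and cond: "fst ` set hs \<subseteq> K \<inter> V A \<longrightarrow> (\<exists>h\<in>set hs. snd h \<noteq> Some (R, map fst hs))"
      and Ss: "list_all2 (\<lambda>h S. S \<in> m h) hs Ss"
    \<comment> \<open>Each selection of colours comes from an actual tuple \<open>hs'\<close>: an
      occurrence of \<open>(0, None)\<close> is replaced by a root choice outside \<open>A\<close>.
      Such a choice never equals a block of \<open>A\<close>, so the condition of \<open>HR\<close>
      persists.\<close>
    define Q where "Q h h' \<longleftrightarrow> fst h' = fst h \<and> h' \<in> HV ?C K \<and> (h' = h \<or> \<not> inA h')" for h h' :: "'r choice"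
    have "list_all2 (\<lambda>h S. \<exists>h'. Q h h' \<and> c h' = S) hs Ss"
    proof (rule list.rel_mono_strong[OF Ss])
      fix h S assume h: "h \<in> set hs" "S \<in> m h"
      show "\<exists>h'. Q h h' \<and> c h' = S"
      proof (cases "h = (0, None)")
        case True
        then show ?thesis using h(2) by (auto simp: m_def Q_def)
      next
        case False
        then have "h \<in> HV ?C K" using h(1) hs(2) HA[of h] by blast
        moreover have "c h = S" using False h(2) by (simp add: m_def)
        ultimately show ?thesis by (intro exI[of _ h]) (simp add: Q_def)
      qed
    qed
    then obtain hs' where hs': "list_all2 Q hs hs'" "map c hs' = Ss" using list_all2_choose by blast
    have len: "length hs = length hs'" using hs'(1) by (rule list_all2_lengthD)
    have Qi: "Q (hs ! i) (hs' ! i)" if "i < length hs" for i using hs'(1) that by (rule list_all2_nthD)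
    have fst: "map fst hs' = map fst hs"
      using Qi len by (intro nth_equalityI) (auto simp: Q_def)
    have "hs' \<in> HR ?C K N R"
    proof (rule HR_I)
      show "set hs' \<subseteq> HV ?C K"
      proof
        fix k assume "k \<in> set hs'"
        then obtain i where "i < length hs'" "k = hs' ! i" by (metis in_set_conv_nth)
        then show "k \<in> HV ?C K" using Qi[of i] len unfolding Q_def by simp
      qed
      show "map fst hs' \<in> Rel ?C R" using fst hs(1) by simp
      have "hs \<noteq> []" using AV[OF hs(1)] by auto
      then show "R \<notin> N" if "hs' = []" using len that by simp
      assume "fst ` set hs' \<subseteq> K"
      then have "fst ` set hs \<subseteq> K \<inter> V A" using fst AV(1)[OF hs(1)] by (metis le_inf_iff list.set_map)
      then obtain i where i: "i < length hs" "snd (hs ! i) \<noteq> Some (R, map fst hs)"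
        using cond by (metis in_set_conv_nth)
      have "snd (hs' ! i) \<noteq> Some (R, map fst hs)"
        using Qi[OF i(1)] i(2) hs(1) by (auto simp: Q_def inA_def)
      then show "\<exists>h\<in>set hs'. snd h \<noteq> Some (R, map fst hs')" using i(1) len fst by (metis nth_mem)
    qed
    moreover have "hs' \<noteq> []" using AV[OF hs(1)] len by auto
    ultimately show "tuple_ok R Ss" using c hs'(2) unfolding good_def by blast
  qed
  then have "(W, X, Y) \<in> profile A (K \<inter> V A)" unfolding profile_def X_def Y_def by blast
  moreover have Wcol: "W \<subseteq> Collect colour" using c by (auto simp: W_def good_def)
  ultimately have "(W, X, Y) \<in> profile A' (K' \<inter> V A')" using prof by blast
  then obtain m' where m': "multicolouring A' (K' \<inter> V A') W m'"
    and X': "X = (\<Union>h\<in>{h\<in>HV A' (K' \<inter> V A'). fst h = 0 \<and> snd h \<noteq> None}. m' h)"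
    and Y': "Y = m' (0, None)"
    unfolding profile_def by blast
  note ne = multicolouringD(1)[OF m'] and sub = multicolouringD(2)[OF m'] and ok = multicolouringD(3)[OF m']
  \<comment> \<open>If the root is outside \<open>K'\<close>, its only lifted point
    \<open>(0, None)\<close> is left to the \<open>B\<close> side, where it keeps its colour under
    \<open>c\<close>.\<close>
  define AH where "AH = {h \<in> HV A' (K' \<inter> V A'). h \<noteq> (0, None)}"
  define c' where "c' h = (if h \<in> AH then (SOME S. S \<in> m' h) else c h)" for h
  have cA: "c' h \<in> m' h" if "h \<in> AH" for h
    using ne[of h] that some_in_eq[of "m' h"] by (simp add: c'_def AH_def)
  have cB: "h \<in> HV ?C K \<and> fst h \<in> V B \<and> c' h = c h" if "h \<in> HV ?C' K'" "h \<notin> AH" for h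
  proof -
    obtain x z where h: "h = (x, z)" by force
    have "(x, z) \<in> HV ?C K \<and> x \<in> V B"
    proof (cases "x \<in> K'")
      case True
      then obtain R xs where z: "z = Some (R, xs)" "xs \<in> Rel A' R \<union> Rel B R" "x \<in> set xs"
        using \<open>h \<in> HV ?C' K'\<close> by (auto simp: h HV_iff)
      have "xs \<notin> Rel A' R"
        using \<open>h \<notin> AH\<close> True z AV'(1)[of xs R] by (auto simp: h AH_def HV_iff)
      then have "xs \<in> Rel B R" "x \<in> V B" using z B(2) by blast+
      then show ?thesis using True K z by (auto simp: HV_iff)
    next
      case False
      then have z: "z = None" "x \<in> V A' \<union> V B" using \<open>h \<in> HV ?C' K'\<close> by (auto simp: h HV_iff)
      have "x \<in> V B"
        using \<open>h \<notin> AH\<close> False z B(1) by (auto simp: h AH_def HV_iff)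
      then show ?thesis using False K z by (auto simp: HV_iff)
    qed
    then show ?thesis using \<open>h \<notin> AH\<close> by (simp add: h c'_def)
  qed
  have c'W: "c' h \<in> W" if "h \<in> HV ?C' K'" for h
  proof (cases "h \<in> AH")
    case True
    then have "h \<in> insert (0, None) (HV A' (K' \<inter> V A'))" by (simp add: AH_def)
    then show ?thesis using cA[OF True] sub by blast
  next
    case False
    then show ?thesis using cB[OF that] by (simp add: W_def)
  qed
  have Wpair: "pair_ok S T" if "S \<in> W" "T \<in> W" for S T
    using that c unfolding W_def good_def by (elim imageE) simp
  have Wnull: "nullary_ok R S" if "[] \<in> HR ?C K N R" "S \<in> W" for R S
    using that c unfolding W_def good_def by (elim imageE) simp
  have "good c' (HV ?C' K') (HR ?C' K' N)"
    unfolding good_def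
  proof (intro conjI ballI allI impI)
    show "colour (c' h)" if "h \<in> HV ?C' K'" for h using c'W[OF that] Wcol by blast
    show "pair_ok (c' h) (c' h')" if "h \<in> HV ?C' K'" "h' \<in> HV ?C' K'" for h h'
      using Wpair c'W that by blast
    show "nullary_ok R (c' h)" if "[] \<in> HR ?C' K' N R" "h \<in> HV ?C' K'" for R h
    proof -
      have "[] \<in> Rel B R" "R \<notin> N"
        using HR_D(2,3)[OF that(1)] AV'(2)[of "[]" R] by auto
      then have "[] \<in> HR ?C K N R" by (intro HR_I) auto
      then show ?thesis using Wnull c'W[OF that(2)] by blast
    qed
    fix R hs assume hs: "hs \<in> HR ?C' K' N R" "hs \<noteq> []"
    define xs where "xs = map fst hs"
    have fsthd: "fst h \<in> set xs" if "h \<in> set hs" for h using that by (simp add: xs_def)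
    have hV: "h \<in> HV ?C' K'" if "h \<in> set hs" for h using HR_D(1)[OF hs(1)] that by blast
    have cond: "\<exists>h\<in>set hs. snd h \<noteq> Some (R, xs)" if "set xs \<subseteq> K'"
      using HR_D(4)[OF hs] that unfolding xs_def by simp
    consider (in_A) "xs \<in> Rel A' R" | (in_B) "xs \<in> Rel B R" using HR_D(2)[OF hs(1)] by (auto simp: xs_def)
    then show "tuple_ok R (map c' hs)"
    proof cases
      case in_A
      define \<rho> where "\<rho> h = (if h \<in> AH then h else (0, None))" for h :: "'r choice"
      have f0: "fst h = 0" if "h \<in> set hs" "h \<notin> AH" for h
        using cB[OF hV that(2)] fsthd AV'(1)[OF in_A] that disj(2) by blast
      have fst: "map fst (map \<rho> hs) = xs" using f0 by (auto simp: xs_def \<rho>_def)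
      show ?thesis
      proof (rule ok[of "map \<rho> hs"])
        show "map fst (map \<rho> hs) \<in> Rel A' R" using fst in_A by simp
        show "set (map \<rho> hs) \<subseteq> insert (0, None) (HV A' (K' \<inter> V A'))"
          by (auto simp: \<rho>_def AH_def)
        assume "fst ` set (map \<rho> hs) \<subseteq> K' \<inter> V A'"
        then have "set xs \<subseteq> K'" using fst by (metis le_inf_iff list.set_map)
        then obtain h where "h \<in> set hs" "snd h \<noteq> Some (R, xs)" using cond by blast
        then show "\<exists>h\<in>set (map \<rho> hs). snd h \<noteq> Some (R, map fst (map \<rho> hs))"
          unfolding fst by (intro bexI[of _ "\<rho> h"]) (auto simp: \<rho>_def)
      next
        have "c' h \<in> m' (\<rho> h)" if h: "h \<in> set hs" for h
        proof (cases "h \<in> AH")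
          case True
          then show ?thesis using cA by (simp add: \<rho>_def)
        next
          case False
          note hB = cB[OF hV[OF h] False]
          \<comment> \<open>\<open>A\<close> and \<open>A'\<close> may have tuples in common, but a
            root choice in a common tuple would lie in \<open>AH\<close>; and \<open>A\<close>
            shares no tuple with \<open>B\<close>.\<close>
          have "\<not> inA h"
          proof
            assume "inA h"
            then obtain R1 us where us: "snd h = Some (R1, us)" "us \<in> Rel A R1" by (auto simp: inA_def)
            have "us \<in> Rel A' R1 \<union> Rel B R1" "0 \<in> K'" "0 \<in> set us"
              using hV[OF h] us(1) f0[OF h False] by (cases h; auto simp: HV_iff)+
            moreover have "us \<notin> Rel B R1" using sep us by blast
            ultimately have "h \<in> AH"
              using us f0[OF h False] zero(2) by (cases h) (auto simp: AH_def HV_iff)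
            then show False using False by blast
          qed
          then have "c h \<in> Y" using hB f0[OF h False] by (auto simp: Y_def m_def)
          then show ?thesis using False hB Y' by (simp add: \<rho>_def)
        qed
        then show "list_all2 (\<lambda>h S. S \<in> m' h) (map \<rho> hs) (map c' hs)"
          by (simp add: list_all2_conv_all_nth)
      qed
    next
      case in_B
      define Q where "Q h h' \<longleftrightarrow> fst h' = fst h \<and> h' \<in> HV ?C K \<and> (h' = h \<or> inA h')" for h h' :: "'r choice"
      have "\<exists>h'. Q h h' \<and> c h' = c' h" if h: "h \<in> set hs" for h
      proof (cases "h \<in> AH")
        case True
        have f: "fst h \<in> V B" using fsthd[OF h] in_B B(2) by blast
        have "fst h \<in> V A'"
          using True AV'(1) by (cases h) (auto simp: AH_def HV_iff)
        then have f0: "fst h = 0" using f disj(2) by blast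
        then have "h \<in> {h\<in>HV A' (K' \<inter> V A'). fst h = 0 \<and> snd h \<noteq> None}"
          using True by (cases h) (auto simp: AH_def)
        then have "c' h \<in> X" using cA[OF True] X' by blast
        then obtain h' where h': "h' \<in> HV A (K \<inter> V A)" "fst h' = 0" "snd h' \<noteq> None" "c' h \<in> m h'"
          unfolding X_def by blast
        then have "c h' = c' h" "inA h'"
          by (cases h'; auto simp: m_def inA_def HV_iff)+
        then show ?thesis using h'(1,2) f0 HA by (intro exI[of _ h']) (simp add: Q_def)
      next
        case False
        then show ?thesis using cB[OF hV[OF h]] by (intro exI[of _ h]) (simp add: Q_def)
      qed
      then have "list_all2 (\<lambda>h S. \<exists>h'. Q h h' \<and> c h' = S) hs (map c' hs)"
        by (simp add: list_all2_conv_all_nth)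
      then obtain hs' where hs': "list_all2 Q hs hs'" "map c hs' = map c' hs"
        using list_all2_choose by blast
      have len: "length hs = length hs'" using hs'(1) by (rule list_all2_lengthD)
      have Qi: "Q (hs ! i) (hs' ! i)" if "i < length hs" for i using hs'(1) that by (rule list_all2_nthD)
      have fst: "map fst hs' = xs"
        unfolding xs_def using Qi len by (intro nth_equalityI) (auto simp: Q_def)
      have "hs' \<in> HR ?C K N R"
      proof (rule HR_I)
        show "set hs' \<subseteq> HV ?C K"
      proof
        fix k assume "k \<in> set hs'"
        then obtain i where "i < length hs'" "k = hs' ! i" by (metis in_set_conv_nth)
        then show "k \<in> HV ?C K" using Qi[of i] len unfolding Q_def by simp
      qed
        show "map fst hs' \<in> Rel ?C R" using fst in_B by simp
        show "R \<notin> N" if "hs' = []" using len that hs(2) by simp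
        assume "fst ` set hs' \<subseteq> K"
        then have "set xs \<subseteq> K" using fst by (metis list.set_map)
        then have "set xs \<subseteq> K'" using B(2)[OF in_B] K by blast
        then obtain i where i: "i < length hs" "snd (hs ! i) \<noteq> Some (R, xs)"
          using cond by (metis in_set_conv_nth)
        have "snd (hs' ! i) \<noteq> Some (R, xs)"
          using Qi[OF i(1)] i(2) in_B sep by (auto simp: Q_def inA_def)
        then show "\<exists>h\<in>set hs'. snd h \<noteq> Some (R, map fst hs')" using i(1) len fst by (metis nth_mem)
      qed
      moreover have "hs' \<noteq> []" using hs(2) len by auto
      ultimately show ?thesis using c hs'(2) unfolding good_def by metis
    qed
  qed
  then show ?thesis using liftable_def by blast
qed

end


section \<open>Regularity\<close>

definition strip :: "'r sstruct \<Rightarrow> 'r sstruct" where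
  "strip A = \<lparr>V = V A, Rel = (\<lambda>R. {xs \<in> Rel A R. \<not> set xs \<subseteq> {0}})\<rparr>"

definition pins :: "'r set \<Rightarrow> ('r \<Rightarrow> nat) \<Rightarrow> 'r sstruct \<Rightarrow> 'r set" where
  "pins sig ar A = {R \<in> sig. replicate (ar R) 0 \<in> Rel A R}"

definition pinned :: "('r \<Rightarrow> nat) \<Rightarrow> 'r set \<Rightarrow> 'r sstruct" where
  "pinned ar L = \<lparr>V = {0}, Rel = (\<lambda>R. if R \<in> L then {replicate (ar R) 0} else {})\<rparr>"

text \<open>Blocks all of whose entries are the root may occur on both sides of a glueing; they are moved
  to the right-hand side.\<close>

lemma glue_decomp:
  assumes A: "wf_struct sig ar A" "a \<in> V A"
  shows "glue A a B b = sunion (strip (img (emb_l a) A))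
    (sunion (pinned ar (pins sig ar (img (emb_l a) A))) (img (emb_r b) B))"
    (is "_ = sunion (strip ?A) (sunion ?P ?B)")
proof (rule sstruct.equality)
  have "0 \<in> V ?A" using A(2) by (auto simp: img_def emb_l_def intro: image_eqI[of _ _ a])
  then show "V (glue A a B b) = V (sunion (strip ?A) (sunion ?P ?B))"
    by (auto simp: glue_def strip_def pinned_def img_def)
  show "Rel (glue A a B b) = Rel (sunion (strip ?A) (sunion ?P ?B))"
  proof
    fix R
    have R: "R \<in> sig \<and> length xs = ar R" if "xs \<in> Rel ?A R" for xs
      using that wfD(1,2)[OF A(1)] by (auto simp: img_def)
    have "xs = replicate (ar R) 0" if "xs \<in> Rel ?A R" "set xs \<subseteq> {0}" for xs
      using R[OF that(1)] that(2) by (auto intro!: replicate_eqI)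
    then have "Rel ?A R = Rel (strip ?A) R \<union> Rel ?P R"
      using R by (auto simp: strip_def pinned_def pins_def)
    then show "Rel (glue A a B b) R = Rel (sunion (strip ?A) (sunion ?P ?B)) R"
      by (auto simp: glue_def img_def)
  qed
qed simp

lemma unpinned_strip:
  assumes A: "wf_struct sig ar A" "a \<in> V A"
  shows "unpinned (strip (img (emb_l a) A))"
proof -
  have "set xs \<subseteq> V (img (emb_l a) A)" if xs: "xs \<in> Rel (img (emb_l a) A) R" for xs R
  proof -
    obtain ys where "ys \<in> Rel A R" "xs = map (emb_l a) ys" using xs by (auto simp: img_def)
    then show ?thesis using wfD(3)[OF A(1), of ys R] by (auto simp: img_def)
  qed
  moreover have "0 \<in> V (img (emb_l a) A)"
    using A(2) by (auto simp: img_def emb_l_def intro: image_eqI[of _ _ a])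
  ultimately show ?thesis by (auto simp: unpinned_def strip_def)
qed

section \<open>Finite data that determine a residual\<close>

context forest_class
begin

text \<open>Cutting the profiles down to genuine colours leaves finitely many. The flags record
  whether \<open>K\<close> contains the root, which is needed to match it with a set on the other
  side, and whether it is empty, which enters \<open>nontrivial\<close>.\<close>

definition component_profiles :: "'r sstruct \<Rightarrow> (bool \<times> bool \<times> (('r sstruct \<times> nat) set set \<times>
    ('r sstruct \<times> nat) set set \<times> ('r sstruct \<times> nat) set set) set) set" where
  "component_profiles A =
     {(0 \<in> K, K = {}, profile A K \<inter> {(W, X, Y). W \<subseteq> Collect colour}) |K. comp_set A K}"

text \<open>The part of \<open>K'\<close> in \<open>A'\<close> is replaced by a set
  \<open>K0\<close> in \<open>A\<close> with the same data, and the part in \<open>B\<close> is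
  kept. The two fit together because they agree on whether the root belongs to them.\<close>

lemma liftable_correspond:
  assumes A: "unpinned A" and A': "unpinned A'" and B: "0 \<in> V B" "\<And>R xs. xs \<in> Rel B R \<Longrightarrow> set xs \<subseteq> V B"
    and disj: "V A \<inter> V B = {0}" "V A' \<inter> V B = {0}"
    and eq: "component_profiles A = component_profiles A'"
    and K': "comp_set (sunion A' B) K'"
  shows "\<exists>K. comp_set (sunion A B) K \<and> (K = {} \<longleftrightarrow> K' = {}) \<and>
    (\<forall>N. liftable (sunion A B) K N \<longleftrightarrow> liftable (sunion A' B) K' N)"
proof -
  have zero: "0 \<in> V A" "0 \<in> V A'" using A A' by (auto simp: unpinned_def)
  have tupA: "set xs \<subseteq> V A" if "xs \<in> Rel A R" for xs R using A that by (auto simp: unpinned_def)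
  have tupA': "set xs \<subseteq> V A'" if "xs \<in> Rel A' R" for xs R using A' that by (auto simp: unpinned_def)
  have K'V: "K' \<subseteq> V A' \<union> V B" and K'A: "\<And>R xs. xs \<in> Rel A' R \<Longrightarrow> set xs \<inter> K' \<noteq> {} \<Longrightarrow> set xs \<subseteq> K'"
    and K'B: "\<And>R xs. xs \<in> Rel B R \<Longrightarrow> set xs \<inter> K' \<noteq> {} \<Longrightarrow> set xs \<subseteq> K'"
    using K' unfolding comp_set_def by auto
  have "comp_set A' (K' \<inter> V A')"
    unfolding comp_set_def
  proof (intro conjI allI ballI impI)
    fix R xs assume xs: "xs \<in> Rel A' R" "set xs \<inter> (K' \<inter> V A') \<noteq> {}"
    then have "set xs \<inter> K' \<noteq> {}" by blast
    then show "set xs \<subseteq> K' \<inter> V A'" using K'A[OF xs(1)] tupA'[OF xs(1)] by simp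
  qed simp
  then have "(0 \<in> K' \<inter> V A', K' \<inter> V A' = {}, profile A' (K' \<inter> V A') \<inter> {(W, X, Y). W \<subseteq> Collect colour})
      \<in> component_profiles A"
    unfolding eq unfolding component_profiles_def by blast
  then obtain K0 where K0: "comp_set A K0" "0 \<in> K' \<inter> V A' \<longleftrightarrow> 0 \<in> K0" "K' \<inter> V A' = {} \<longleftrightarrow> K0 = {}"
    and prof: "profile A' (K' \<inter> V A') \<inter> {(W, X, Y). W \<subseteq> Collect colour} =
      profile A K0 \<inter> {(W, X, Y). W \<subseteq> Collect colour}"
    unfolding component_profiles_def by auto
  define K where "K = K0 \<union> (K' \<inter> V B)"
  have K0V: "K0 \<subseteq> V A" using K0(1) by (simp add: comp_set_def)
  have z: "0 \<in> K0 \<longleftrightarrow> 0 \<in> K'" using K0(2) zero by blast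
  have root: "x = 0" if "x \<in> V A" "x \<in> V B" for x using disj(1) that by blast
  have KA: "K \<inter> V A = K0"
  proof (rule set_eqI)
    show "x \<in> K \<inter> V A \<longleftrightarrow> x \<in> K0" for x using root[of x] z K0V by (auto simp: K_def)
  qed
  have KB: "K \<inter> V B = K' \<inter> V B"
  proof (rule set_eqI)
    show "x \<in> K \<inter> V B \<longleftrightarrow> x \<in> K' \<inter> V B" for x using root[of x] z K0V by (auto simp: K_def)
  qed
  have "comp_set (sunion A B) K"
    unfolding comp_set_def
  proof (intro conjI allI ballI impI)
    show "K \<subseteq> V (sunion A B)" using K0V by (auto simp: K_def)
    fix R xs assume xs: "xs \<in> Rel (sunion A B) R" "set xs \<inter> K \<noteq> {}"
    then consider "xs \<in> Rel A R" | "xs \<in> Rel B R" by auto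
    then show "set xs \<subseteq> K"
    proof cases
      case 1
      then have "set xs \<inter> K0 \<noteq> {}" using xs(2) tupA KA by blast
      then have "set xs \<subseteq> K0" using K0(1) 1 by (simp add: comp_set_def)
      then show ?thesis by (auto simp: K_def)
    next
      case 2
      then have "set xs \<inter> K' \<noteq> {}" using xs(2) B(2)[OF 2] KB by blast
      then show ?thesis using K'B[OF 2] B(2)[OF 2] by (auto simp: K_def)
    qed
  qed
  moreover have "K = {} \<longleftrightarrow> K' = {}"
  proof -
    have "K' = (K' \<inter> V A') \<union> (K' \<inter> V B)" using K'V by blast
    then show ?thesis using K0(3) unfolding K_def by blast
  qed
  moreover have "liftable (sunion A B) K N \<longleftrightarrow> liftable (sunion A' B) K' N" for N
  proof
    show "liftable (sunion A' B) K' N" if "liftable (sunion A B) K N"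
      by (rule liftable_transfer[OF A A' B(1) _ disj KB _ that]) (use B(2) prof KA in auto)
    show "liftable (sunion A B) K N" if "liftable (sunion A' B) K' N"
      by (rule liftable_transfer[OF A' A B(1) _ disj(2,1) KB[symmetric] _ that]) (use B(2) prof KA in auto)
  qed
  ultimately show ?thesis by blast
qed

text \<open>Equal \<open>pins\<close> make the right-hand part \<open>B'\<close>, which takes over
  all root-only tuples, common to both glueings; the clauses of \<open>cores_iff_liftable\<close>
  are then transferred one by one. As the hypotheses are symmetric, inclusion is enough for
  equality.\<close>

lemma residual_cores_mono:
  assumes A: "is_forest sig ar A" "a \<in> V A" and A': "is_forest sig ar A'" "a' \<in> V A'"
    and pins: "pins sig ar (img (emb_l a) A) = pins sig ar (img (emb_l a') A')"
    and prof: "component_profiles (strip (img (emb_l a) A)) = component_profiles (strip (img (emb_l a') A'))"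
  shows "residual sig ar (cores sig ar Ob) A a \<subseteq> residual sig ar (cores sig ar Ob) A' a'"
proof clarify
  fix B b assume "(B, b) \<in> residual sig ar (cores sig ar Ob) A a"
  then have B: "is_forest sig ar B" "b \<in> V B" and core: "glue A a B b \<in> cores sig ar Ob"
    by (auto simp: residual_def)
  let ?A = "strip (img (emb_l a) A)" and ?A' = "strip (img (emb_l a') A')"
  define B' where "B' = sunion (pinned ar (pins sig ar (img (emb_l a) A))) (img (emb_r b) B)"
  have C: "glue A a B b = sunion ?A B'" and C': "glue A' a' B b = sunion ?A' B'"
    using glue_decomp[OF forest_wf[OF A(1)] A(2)] glue_decomp[OF forest_wf[OF A'(1)] A'(2)] pins
    by (simp_all add: B'_def)
  have u: "unpinned ?A" "unpinned ?A'"
    using unpinned_strip A A' forest_wf by blast+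
  have zB: "0 \<in> V B'" by (simp add: B'_def pinned_def)
  have tupB: "set xs \<subseteq> V B'" if xs: "xs \<in> Rel B' R" for xs R
  proof -
    consider "set xs \<subseteq> {0}" | ys where "ys \<in> Rel B R" "xs = map (emb_r b) ys"
    proof -
      have "xs = replicate (ar R) 0 \<or> xs \<in> map (emb_r b) ` Rel B R"
        using xs by (auto simp: B'_def pinned_def img_def split: if_splits)
      moreover have "set (replicate (ar R) 0) \<subseteq> {0 :: nat}" by auto
      ultimately show thesis using that by blast
    qed
    then show ?thesis
    proof cases
      case 2
      then show ?thesis using wfD(3)[OF forest_wf[OF B(1)] 2(1)] by (auto simp: B'_def img_def)
    qed (use zB in auto)
  qed
  have VB: "V B' = insert 0 (emb_r b ` V B)" by (simp add: B'_def pinned_def img_def)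
  have disj: "V (strip (img (emb_l c) D)) \<inter> V B' = {0}" if "c \<in> V D" for c and D :: "'r sstruct"
    using that by (auto simp: VB strip_def img_def emb_l_def emb_r_def split: if_splits intro: image_eqI[of _ _ c]) presburger+
  have FC: "is_forest sig ar (sunion ?A B')" "is_forest sig ar (sunion ?A' B')"
    using is_forest_glue[OF A B] is_forest_glue[OF A' B] C C' by simp_all
  have ne: "V (sunion ?A B') \<noteq> {}" "V (sunion ?A' B') \<noteq> {}" using zB by auto
  \<comment> \<open>Nullary tuples are stripped from the left parts and so come from
    \<open>B'\<close>. They are all that a vertexless element of \<open>Ob\<close> or a
    \<open>nontrivial\<close> set \<open>N\<close> can see.\<close>
  have nil: "[] \<in> Rel (sunion ?A B') R \<longleftrightarrow> [] \<in> Rel (sunion ?A' B') R" for R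
    by (simp add: strip_def)
  have "sunion ?A B' \<in> cores sig ar Ob" using core C by simp
  then have crit: "\<forall>D\<in>Ob. V D = {} \<longrightarrow> \<not> homto D (sunion ?A B')" "\<not> liftable (sunion ?A B') {} {}"
    "\<forall>K N. comp_set (sunion ?A B') K \<longrightarrow> nontrivial (sunion ?A B') K N \<longrightarrow> liftable (sunion ?A B') K N"
    unfolding cores_iff_liftable[OF FC(1) ne(1)] by blast+
  have corr: "\<exists>K. comp_set (sunion ?A B') K \<and> (K = {} \<longleftrightarrow> K' = {}) \<and>
      (\<forall>N. liftable (sunion ?A B') K N \<longleftrightarrow> liftable (sunion ?A' B') K' N)"
    if "comp_set (sunion ?A' B') K'" for K'
    by (rule liftable_correspond[OF u zB _ disj[OF A(2)] disj[OF A'(2)] prof that]) (rule tupB)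
  have "sunion ?A' B' \<in> cores sig ar Ob"
    unfolding cores_iff_liftable[OF FC(2) ne(2)]
  proof (intro conjI ballI allI impI)
    fix D assume D: "D \<in> Ob" "V D = {}"
    have nilD: "zs = []" if "zs \<in> Rel D R" for zs R
      using wfD(3)[OF forest_wf[OF ObD[OF D(1)]] that] D(2) by simp
    have "homto D (sunion ?A B')" if "homto D (sunion ?A' B')"
    proof -
      obtain g where g: "hom D (sunion ?A' B') g" using \<open>homto D (sunion ?A' B')\<close> homto_def by blast
      have "map g zs \<in> Rel (sunion ?A B') R" if zs: "zs \<in> Rel D R" for zs R
      proof -
        have "map g zs \<in> Rel (sunion ?A' B') R" using g zs unfolding hom_def by blast
        then show ?thesis using nil nilD[OF zs] by simp
      qed
      then have "hom D (sunion ?A B') g" using D(2) unfolding hom_def by simp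
      then show ?thesis unfolding homto_def by blast
    qed
    then show "\<not> homto D (sunion ?A' B')" using crit(1) D by blast
  next
    have "comp_set (sunion ?A' B') {}" by (simp add: comp_set_def)
    from corr[OF this] show "\<not> liftable (sunion ?A' B') {} {}" using crit(2) by auto
  next
    fix K' N assume K': "comp_set (sunion ?A' B') K'" "nontrivial (sunion ?A' B') K' N"
    from corr[OF K'(1)] obtain K where K: "comp_set (sunion ?A B') K" "K = {} \<longleftrightarrow> K' = {}"
      "liftable (sunion ?A B') K N \<longleftrightarrow> liftable (sunion ?A' B') K' N" by blast
    then have "nontrivial (sunion ?A B') K N" using K'(2) nil by (simp add: nontrivial_def)
    then show "liftable (sunion ?A' B') K' N" using crit(3) K by blast
  qed
  then show "(B, b) \<in> residual sig ar (cores sig ar Ob) A' a'"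
    using B C' by (simp add: residual_def)
qed

text \<open>The components \<open>X\<close> and \<open>Y\<close> of a profile are contained in
  \<open>W\<close>, so bounding \<open>W\<close> by the finite set of colours bounds the whole
  triple.\<close>

lemma finite_component_profiles:
  assumes "regular sig ar Ob"
  shows "finite (range component_profiles)"
proof (rule finite_subset)
  let ?P = "Pow (Collect colour)"
  show "range component_profiles \<subseteq> Pow (UNIV \<times> UNIV \<times> Pow (?P \<times> ?P \<times> ?P))"
  proof (intro image_subsetI PowI subsetI)
    fix A :: "'r sstruct" and t
    assume t: "t \<in> component_profiles A"
    obtain b1 b2 Z where bZ: "t = (b1, b2, Z)" by (cases t)
    with t obtain K where Z: "Z = profile A K \<inter> {(W, X, Y). W \<subseteq> Collect colour}"
      by (auto simp: component_profiles_def)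
    have "X \<subseteq> W \<and> Y \<subseteq> W" if "(W, X, Y) \<in> profile A K" for W X Y
    proof -
      obtain m where m: "multicolouring A K W m" and
        X: "X = (\<Union>h\<in>{h\<in>HV A K. fst h = 0 \<and> snd h \<noteq> None}. m h)" and Y: "Y = m (0, None)"
        using \<open>(W, X, Y) \<in> profile A K\<close> unfolding profile_def by blast
      show ?thesis unfolding X Y using multicolouringD(2)[OF m] by blast
    qed
    moreover have "(W, X, Y) \<in> profile A K \<and> W \<subseteq> Collect colour" if "(W, X, Y) \<in> Z" for W X Y
      using that unfolding Z by simp
    ultimately have "W \<in> ?P \<and> X \<in> ?P \<and> Y \<in> ?P" if "(W, X, Y) \<in> Z" for W X Y
      using that by (meson Pow_iff subset_trans)
    then have "t' \<in> ?P \<times> ?P \<times> ?P" if "t' \<in> Z" for t'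
      using that by (cases t') (simp del: Pow_iff)
    then have "Z \<subseteq> ?P \<times> ?P \<times> ?P" by (rule subsetI)
    then show "t \<in> UNIV \<times> UNIV \<times> Pow (?P \<times> ?P \<times> ?P)" by (simp add: bZ)
  qed
  show "finite (Pow (UNIV \<times> UNIV \<times> Pow (?P \<times> ?P \<times> ?P)) :: (bool \<times> bool \<times> _) set set)"
    using finite_colours[OF assms] by (simp add: finite_UNIV)
qed

text \<open>Residuals test only glued forests, so the criterion for forests suffices although
  \<open>cores\<close> ranges over all structures. The residual map factors through
  \<open>F\<close>, whose values form a finite set.\<close>

lemma regular_cores:
  assumes "regular sig ar Ob"
  shows "regular sig ar (cores sig ar Ob)"
proof -
  define F where "F = (\<lambda>p :: 'r sstruct \<times> nat. (pins sig ar (img (emb_l (snd p)) (fst p)),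
    component_profiles (strip (img (emb_l (snd p)) (fst p)))))"
  define r where "r p = residual sig ar (cores sig ar Ob) (fst p) (snd p)" for p
  have "F ` RF \<subseteq> Pow sig \<times> range component_profiles" by (auto simp: F_def pins_def)
  then have fin: "finite (F ` RF)"
    using finite_sig finite_component_profiles[OF assms] finite_subset by blast
  have mono: "r p \<subseteq> r q" if "p \<in> RF" "q \<in> RF" "F p = F q" for p q
    unfolding r_def using that(3) rforestsD(1,3)[OF that(1)] rforestsD(1,3)[OF that(2)]
    by (intro residual_cores_mono) (simp_all add: F_def)
  have "r p = r q" if "p \<in> RF" "q \<in> RF" "F p = F q" for p q
    using mono[OF that] mono[OF that(2,1) that(3)[symmetric]] by (rule equalityI)
  then have "r ` RF \<subseteq> (\<lambda>z. r (inv_into RF F z)) ` F ` RF"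
    by (smt (verit) f_inv_into_f image_eqI image_subsetI inv_into_into)
  then have "finite (r ` RF)" using fin finite_subset by blast
  moreover have "r ` RF = {residual sig ar (cores sig ar Ob) A a |A a. is_forest sig ar A \<and> a \<in> V A}"
    by (force simp: rforests_def r_def image_iff)
  ultimately show ?thesis by (simp add: regular_def)
qed

end

theorem theorem5p4:
  fixes sig :: "'r set" and ar :: "'r \<Rightarrow> nat" and Ob :: "'r sstruct set"
  assumes "finite sig"
    and "Ob \<subseteq> forests sig ar"
    and "iso_closed sig ar Ob"
    and "regular sig ar Ob"
  shows "regular sig ar {C. \<exists>A. minimal_in Ob A \<and> is_core sig ar A C}"
proof -
  interpret forest_class sig ar Ob by unfold_locales (fact assms)+
  show ?thesis using regular_cores[OF assms(4)] by (simp add: cores_def)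
qed

end
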